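(* Let $L$ be an $n$-dimensional nilpotent Lie algebra with $\dim L^2=1$, and let $m\ge 1$ be the integer such that $L\cong H(m)\oplus A(n-2m-1)$. Then \[\mathcal{M}^{(2)}(L)\cong\begin{cases} A\!\left(\tfrac{1}{3}n(n-1)(n-2)\right) & \text{if } m>1,\\[2pt] A\!\left(\tfrac{1}{3}n(n-1)(n-2)+3\right) & \text{if } m=1.\end{cases}\]
   Context: All Lie algebras are over a fixed field. For a Lie algebra $L$ with free presentation $L\cong F/R$, the $2$-nilpotent multiplier is $\mathcal{M}^{(2)}(L)=(R\cap F^{3})/[[R,F],F]$, where $F^3=[[F,F],F]$. $A(k)$ denotes the abelian Lie algebra of dimension $k$. The Heisenberg Lie algebra $H(m)$ is the Lie algebra of dimension $2m+1$ with $H(m)^2=Z(H(m))$ and $\dim H(m)^2=1$. Every finite dimensional nilpotent Lie algebra $L$ with $\dim L^2=1$ is isomorphic to $H(m)\oplus A(n-2m-1)$ for a unique $m\ge1$. *)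

theory Defs
  imports Complex_Main "HOL-Library.Function_Algebras"
begin

definition lie_algebra :: "('k::field \<Rightarrow> 'a::ab_group_add \<Rightarrow> 'a) \<Rightarrow> ('a \<Rightarrow> 'a \<Rightarrow> 'a) \<Rightarrow> bool" where
  "lie_algebra s b \<longleftrightarrow> vector_space s
     \<and> (\<forall>x y z. b (x + y) z = b x z + b y z \<and> b x (y + z) = b x y + b x z)
     \<and> (\<forall>c x y. b (s c x) y = s c (b x y) \<and> b x (s c y) = s c (b x y))
     \<and> (\<forall>x. b x x = 0)
     \<and> (\<forall>x y z. b x (b y z) + b y (b z x) + b z (b x y) = 0)"

definition brk :: "('k::field \<Rightarrow> 'a::ab_group_add \<Rightarrow> 'a) \<Rightarrow> ('a \<Rightarrow> 'a \<Rightarrow> 'a) \<Rightarrow> 'a set \<Rightarrow> 'a set \<Rightarrow> 'a set" where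
  "brk s b U V = module.span s {b u v | u v. u \<in> U \<and> v \<in> V}"

text \<open>Lower central series: lcs 0 = L, lcs 1 = L^2, lcs i = L^(i+1).\<close>
primrec lcs :: "('k::field \<Rightarrow> 'a::ab_group_add \<Rightarrow> 'a) \<Rightarrow> ('a \<Rightarrow> 'a \<Rightarrow> 'a) \<Rightarrow> nat \<Rightarrow> 'a set" where
  "lcs s b 0 = UNIV"
| "lcs s b (Suc i) = brk s b (lcs s b i) UNIV"

definition nilpotent_lie :: "('k::field \<Rightarrow> 'a::ab_group_add \<Rightarrow> 'a) \<Rightarrow> ('a \<Rightarrow> 'a \<Rightarrow> 'a) \<Rightarrow> bool" where
  "nilpotent_lie s b \<longleftrightarrow> (\<exists>c. lcs s b c = {0})"

definition lie_ideal :: "('k::field \<Rightarrow> 'a::ab_group_add \<Rightarrow> 'a) \<Rightarrow> ('a \<Rightarrow> 'a \<Rightarrow> 'a) \<Rightarrow> 'a set \<Rightarrow> bool" where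
  "lie_ideal s b I \<longleftrightarrow> module.subspace s I \<and> (\<forall>x\<in>I. \<forall>y. b x y \<in> I)"

definition lie_centre :: "('a::zero \<Rightarrow> 'a \<Rightarrow> 'a) \<Rightarrow> 'a set \<Rightarrow> 'a set" where
  "lie_centre b H = {z \<in> H. \<forall>h\<in>H. b z h = 0}"

definition heisenberg_sub :: "('k::field \<Rightarrow> 'a::ab_group_add \<Rightarrow> 'a) \<Rightarrow> ('a \<Rightarrow> 'a \<Rightarrow> 'a) \<Rightarrow> 'a set \<Rightarrow> nat \<Rightarrow> bool" where
  "heisenberg_sub s b H m \<longleftrightarrow> module.subspace s H \<and> (\<forall>x\<in>H. \<forall>y\<in>H. b x y \<in> H)
     \<and> vector_space.dim s H = 2 * m + 1
     \<and> brk s b H H = lie_centre b H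
     \<and> vector_space.dim s (brk s b H H) = 1"

definition heis_plus_abelian :: "('k::field \<Rightarrow> 'a::ab_group_add \<Rightarrow> 'a) \<Rightarrow> ('a \<Rightarrow> 'a \<Rightarrow> 'a) \<Rightarrow> nat \<Rightarrow> nat \<Rightarrow> bool" where
  "heis_plus_abelian s b m k \<longleftrightarrow> (\<exists>H A. lie_ideal s b H \<and> lie_ideal s b A \<and> H \<inter> A = {0}
       \<and> {h + a | h a. h \<in> H \<and> a \<in> A} = UNIV
       \<and> heisenberg_sub s b H m
       \<and> (\<forall>x\<in>A. \<forall>y\<in>A. b x y = 0) \<and> vector_space.dim s A = k)"

section \<open>Free Lie algebras, as Lie polynomials in the free associative algebra\<close>

text \<open>Noncommutative polynomials over 'k in letters 'x are functions on words.\<close>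
definition fscale :: "'k::field \<Rightarrow> ('x list \<Rightarrow> 'k) \<Rightarrow> ('x list \<Rightarrow> 'k)" where
  "fscale c f = (\<lambda>w. c * f w)"

definition fmul :: "('x list \<Rightarrow> 'k::field) \<Rightarrow> ('x list \<Rightarrow> 'k) \<Rightarrow> ('x list \<Rightarrow> 'k)" where
  "fmul f g = (\<lambda>w. \<Sum>i\<in>{0..length w}. f (take i w) * g (drop i w))"

definition fcomm :: "('x list \<Rightarrow> 'k::field) \<Rightarrow> ('x list \<Rightarrow> 'k) \<Rightarrow> ('x list \<Rightarrow> 'k)" where
  "fcomm f g = fmul f g - fmul g f"

definition letter :: "'x \<Rightarrow> ('x list \<Rightarrow> 'k::field)" where
  "letter x = (\<lambda>w. if w = [x] then 1 else 0)"

inductive_set free_lie :: "'x set \<Rightarrow> ('x list \<Rightarrow> 'k::field) set" for X :: "'x set" where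
  gen: "x \<in> X \<Longrightarrow> letter x \<in> free_lie X"
| zero: "0 \<in> free_lie X"
| add: "f \<in> free_lie X \<Longrightarrow> g \<in> free_lie X \<Longrightarrow> f + g \<in> free_lie X"
| scale: "f \<in> free_lie X \<Longrightarrow> fscale c f \<in> free_lie X"
| comm: "f \<in> free_lie X \<Longrightarrow> g \<in> free_lie X \<Longrightarrow> fcomm f g \<in> free_lie X"

definition fbrk :: "('x list \<Rightarrow> 'k::field) set \<Rightarrow> ('x list \<Rightarrow> 'k) set \<Rightarrow> ('x list \<Rightarrow> 'k) set" where
  "fbrk U V = module.span fscale {fcomm u v | u v. u \<in> U \<and> v \<in> V}"

definition free_presentation :: "('k::field \<Rightarrow> 'a::ab_group_add \<Rightarrow> 'a) \<Rightarrow> ('a \<Rightarrow> 'a \<Rightarrow> 'a) \<Rightarrow> 'x set \<Rightarrow> (('x list \<Rightarrow> 'k) \<Rightarrow> 'a) \<Rightarrow> bool" where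
  "free_presentation s b X phi \<longleftrightarrow>
     (\<forall>f\<in>free_lie X. \<forall>g\<in>free_lie X. phi (f + g) = phi f + phi g \<and> phi (fcomm f g) = b (phi f) (phi g))
   \<and> (\<forall>c. \<forall>f\<in>free_lie X. phi (fscale c f) = s c (phi f))
   \<and> phi ` free_lie X = UNIV"

definition pres_R :: "'x set \<Rightarrow> (('x list \<Rightarrow> 'k::field) \<Rightarrow> 'a::zero) \<Rightarrow> ('x list \<Rightarrow> 'k) set" where
  "pres_R X phi = {f \<in> free_lie X. phi f = 0}"

definition mult2_num :: "'x set \<Rightarrow> (('x list \<Rightarrow> 'k::field) \<Rightarrow> 'a::zero) \<Rightarrow> ('x list \<Rightarrow> 'k) set" where
  "mult2_num X phi = pres_R X phi \<inter> fbrk (fbrk (free_lie X) (free_lie X)) (free_lie X)"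

definition mult2_den :: "'x set \<Rightarrow> (('x list \<Rightarrow> 'k::field) \<Rightarrow> 'a::zero) \<Rightarrow> ('x list \<Rightarrow> 'k) set" where
  "mult2_den X phi = fbrk (fbrk (pres_R X phi) (free_lie X)) (free_lie X)"

text \<open>dim (M / N) = k, for subspaces N \<subseteq> M.\<close>
definition quot_dim :: "('k::field \<Rightarrow> 'b::ab_group_add \<Rightarrow> 'b) \<Rightarrow> 'b set \<Rightarrow> 'b set \<Rightarrow> nat \<Rightarrow> bool" where
  "quot_dim s M N k \<longleftrightarrow> (\<exists>B. finite B \<and> card B = k \<and> B \<subseteq> M \<and> M \<subseteq> module.span s (B \<union> N)
      \<and> (\<forall>c. (\<Sum>v\<in>B. s (c v) v) \<in> N \<longrightarrow> (\<forall>v\<in>B. c v = 0)))"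

text \<open>M^(2)(L) \<cong> A(k): the quotient (R \<inter> F^3)/[[R,F],F] (a subquotient Lie algebra of F) is
  abelian of dimension k.\<close>
definition mult2_iso_abelian :: "'x set \<Rightarrow> (('x list \<Rightarrow> 'k::field) \<Rightarrow> 'a::zero) \<Rightarrow> nat \<Rightarrow> bool" where
  "mult2_iso_abelian X phi k \<longleftrightarrow>
     (\<forall>u\<in>mult2_num X phi. \<forall>v\<in>mult2_num X phi. fcomm u v \<in> mult2_den X phi)
   \<and> quot_dim fscale (mult2_num X phi) (mult2_den X phi) k"

end

theory Submission
  imports Defs
begin

text \<open>Put \<open>d = n - 1\<close> and \<open>D = [[R,F],F]\<close>. As \<open>[L\<^sup>2,L] = 0\<close>, the multiplier is \<open>F\<^sup>3/D\<close>. Choose a basis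
  \<open>e 0, \<dots>, e (d - 1), z\<close> of \<open>L\<close> with \<open>[e 0, e 1] = z\<close> spanning \<open>L\<^sup>2\<close> and all other \<open>e i\<close> commuting with
  \<open>e 0\<close> and \<open>e 1\<close>. Modulo \<open>D\<close>, the space \<open>F\<^sup>3\<close> is spanned by the \<open>[[y i, y j], y k]\<close> with
  \<open>j < i\<close>, \<open>j \<le> k\<close>, where \<open>y i\<close> lifts \<open>e i\<close>, and by the \<open>[[z', y i], y j]\<close>, where
  \<open>z' = [y 0, y 1]\<close>. The Jacobi identity puts \<open>[[z', f], g]\<close> into \<open>D\<close> as soon as \<open>z\<close> is the bracket of two
  elements commuting with the image of \<open>f\<close>. For \<open>m > 1\<close> this kills all \<open>[[z', y i], y j]\<close>; for \<open>m = 1\<close> it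
  leaves \<open>i, j \<le> 1\<close>, and symmetry in \<open>i, j\<close> leaves three elements. Independence is seen by mapping
  \<open>F\<close> to the free associative algebra on \<open>d\<close> letters: \<open>D\<close> lands in degree at least 4 and, for \<open>m = 1\<close>, has no
  words of length 4 in the first two letters.\<close>

section \<open>Free associative algebras\<close>

lemma fscale_apply: "fscale c f w = c * f w"
  by (simp add: fscale_def)

lemma vector_space_fscale: "vector_space (fscale :: 'k::field \<Rightarrow> ('x list \<Rightarrow> 'k) \<Rightarrow> _)"
  by unfold_locales (auto simp: fscale_def fun_eq_iff algebra_simps)

lemma fmul_Nil [simp]: "fmul f g [] = f [] * g []"
  by (simp add: fmul_def)

text \<open>A prefix is empty or begins with \<open>x\<close>; stripping \<open>x\<close> leaves a
  product of the same kind, which opens the way to induction on words.\<close>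

lemma fmul_Cons [simp]: "fmul f g (x # w) = f [] * g (x # w) + fmul (\<lambda>u. f (x # u)) g w"
  by (simp add: fmul_def sum.atLeast0_atMost_Suc_shift del: sum.cl_ivl_Suc)

lemma fmul_add_left: "fmul (f + g) h = fmul f h + fmul g h"
  by (simp add: fmul_def fun_eq_iff algebra_simps sum.distrib)

lemma fmul_add_right: "fmul h (f + g) = fmul h f + fmul h g"
  by (simp add: fmul_def fun_eq_iff algebra_simps sum.distrib)

lemma fmul_diff_left: "fmul (f - g) h = fmul f h - fmul g h"
  by (simp add: fmul_def fun_eq_iff algebra_simps sum_subtractf)

lemma fmul_diff_right: "fmul h (f - g) = fmul h f - fmul h g"
  by (simp add: fmul_def fun_eq_iff algebra_simps sum_subtractf)

lemma fmul_scale_left: "fmul (fscale c f) h = fscale c (fmul f h)"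
  by (simp add: fmul_def fscale_def fun_eq_iff sum_distrib_left mult_ac)

lemma fmul_scale_right: "fmul h (fscale c f) = fscale c (fmul h f)"
  by (simp add: fmul_def fscale_def fun_eq_iff sum_distrib_left mult_ac)

lemma fmul_assoc: "fmul (fmul f g) h = fmul f (fmul g h)"
proof
  fix w show "fmul (fmul f g) h w = fmul f (fmul g h) w"
  proof (induction w arbitrary: f g h)
    case Nil
    show ?case by simp
  next
    case (Cons x w)
    \<comment> \<open>Twisted product rule for stripping \<open>x\<close>; it leaves a triple
      product on the shorter word.\<close>
    have "(\<lambda>u. fmul f g (x # u)) = fscale (f []) (\<lambda>u. g (x # u)) + fmul (\<lambda>u. f (x # u)) g"
      by (simp add: fun_eq_iff fscale_def)
    then have "fmul (\<lambda>u. fmul f g (x # u)) h w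
        = f [] * fmul (\<lambda>u. g (x # u)) h w + fmul (fmul (\<lambda>u. f (x # u)) g) h w"
      by (simp only: fmul_add_left fmul_scale_left) (simp add: fscale_def)
    then show ?case by (simp del: fmul_Cons add: fmul_Cons[of "fmul f g"] fmul_Cons[of f] fmul_Cons[of g] Cons algebra_simps)
  qed
qed

lemma lie_algebra_fcomm:
  "lie_algebra (fscale :: 'k::field \<Rightarrow> ('x list \<Rightarrow> 'k) \<Rightarrow> _) fcomm"
proof -
  interpret fv: vector_space "fscale :: 'k \<Rightarrow> ('x list \<Rightarrow> 'k) \<Rightarrow> _"
    by (rule vector_space_fscale)
  have jac: "fcomm x (fcomm y z) + fcomm y (fcomm z x) + fcomm z (fcomm x y) = 0"
    for x y z :: "'x list \<Rightarrow> 'k"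
    by (simp add: fcomm_def fmul_diff_left fmul_diff_right fmul_assoc)
  show ?thesis
    unfolding lie_algebra_def using vector_space_fscale jac
    by (simp add: fcomm_def fmul_add_left fmul_add_right fmul_scale_left fmul_scale_right
        fv.scale_right_diff_distrib)
qed

section \<open>Substitution of noncommutative polynomials for letters\<close>

definition fone :: "'x list \<Rightarrow> 'k::field" where
  "fone = (\<lambda>w. if w = [] then 1 else 0)"

lemma fmul_fone_left [simp]: "fmul fone f = f"
proof
  fix w show "fmul fone f w = f w"
  proof (cases w)
    case (Cons x u)
    have "(\<lambda>u. fone (x # u)) = (\<lambda>_. 0 :: 'b)" by (simp add: fone_def)
    then show ?thesis using Cons by (simp add: fmul_def[of "\<lambda>_. 0"]) (simp add: fone_def)
  qed (simp add: fone_def)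
qed

primrec word_image :: "('x \<Rightarrow> 'y list \<Rightarrow> 'k::field) \<Rightarrow> 'x list \<Rightarrow> 'y list \<Rightarrow> 'k" where
  "word_image p [] = fone"
| "word_image p (x # w) = fmul (p x) (word_image p w)"

lemma word_image_append: "word_image p (u @ w) = fmul (word_image p u) (word_image p w)"
  by (induction u) (simp_all add: fmul_assoc)

text \<open>The unital algebra homomorphism extending \<open>p\<close>. For infinite support the sum
  takes the default value 0, so additivity and multiplicativity are stated for finite
  support.\<close>

definition substitution :: "('x \<Rightarrow> 'y list \<Rightarrow> 'k::field) \<Rightarrow> ('x list \<Rightarrow> 'k) \<Rightarrow> 'y list \<Rightarrow> 'k" where
  "substitution p f = (\<lambda>v. \<Sum>w | f w \<noteq> 0. f w * word_image p w v)"

text \<open>Polynomials with different supports can then be summed over one common finite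
  set.\<close>

lemma substitution_superset:
  assumes "finite A" "\<And>w. w \<notin> A \<Longrightarrow> f w = 0"
  shows "substitution p f v = (\<Sum>w\<in>A. f w * word_image p w v)"
  unfolding substitution_def
  by (rule sum.mono_neutral_left) (use assms in auto)

lemma substitution_add:
  assumes "finite {w. f w \<noteq> 0}" "finite {w. g w \<noteq> 0}"
  shows "substitution p (f + g) = substitution p f + substitution p g"
proof
  fix v
  let ?A = "{w. f w \<noteq> 0} \<union> {w. g w \<noteq> 0}"
  have "finite ?A" using assms by simp
  then show "substitution p (f + g) v = (substitution p f + substitution p g) v"
    unfolding plus_fun_apply by (subst (1 2 3) substitution_superset[of ?A]) (auto simp: sum.distrib algebra_simps)
qed

lemma substitution_scale: "substitution p (fscale c f) = fscale c (substitution p f)"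
  by (cases "c = 0")
    (simp_all add: substitution_def fscale_def fun_eq_iff sum_distrib_left mult_ac)

lemma support_fmul: "{w. fmul f g w \<noteq> 0} \<subseteq> (\<lambda>(u, v). u @ v) ` ({w. f w \<noteq> 0} \<times> {w. g w \<noteq> 0})"
proof
  fix w assume "w \<in> {w. fmul f g w \<noteq> 0}"
  then have "\<exists>i\<in>{0..length w}. f (take i w) * g (drop i w) \<noteq> 0"
    unfolding fmul_def mem_Collect_eq by (metis (no_types, lifting) sum.neutral)
  then obtain i where "f (take i w) * g (drop i w) \<noteq> 0" by blast
  then show "w \<in> (\<lambda>(u, v). u @ v) ` ({w. f w \<noteq> 0} \<times> {w. g w \<noteq> 0})"
    by (intro image_eqI[of _ _ "(take i w, drop i w)"]) auto
qed

lemma finite_support_fmul: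
  assumes "finite {w. f w \<noteq> 0}" "finite {w. g w \<noteq> 0}"
  shows "finite {w. fmul f g w \<noteq> 0}"
  using support_fmul by (rule finite_subset) (use assms in simp)

lemma substitution_fmul:
  assumes "finite {w. f w \<noteq> 0}" "finite {w. g w \<noteq> 0}"
  shows "substitution p (fmul f g) = fmul (substitution p f) (substitution p g)"
proof
  fix v
  let ?A = "{w. f w \<noteq> 0}" and ?B = "{w. g w \<noteq> 0}"
  let ?C = "(\<lambda>(u, v). u @ v) ` (?A \<times> ?B)"
  have C: "finite ?C" using assms by simp
  \<comment> \<open>A word with a cut position is the same as a pair of words, recovered by cutting
    at \<open>length u\<close>.\<close>
  have split: "take (length u) (u @ w) = u" "drop (length u) (u @ w) = w" for u w :: "'a list"
    by simp_all
  have "substitution p (fmul f g) v = (\<Sum>w\<in>?C. fmul f g w * word_image p w v)"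
    using support_fmul[of f g] by (intro substitution_superset[OF C]) auto
  also have "\<dots> = (\<Sum>(w, i)\<in>Sigma ?C (\<lambda>w. {0..length w}).
      f (take i w) * g (drop i w) * word_image p w v)"
    using C by (simp add: fmul_def sum_distrib_right sum.Sigma)
  \<comment> \<open>Cuts with a zero factor are discarded; the remaining ones match
    \<open>?A \<times> ?B\<close> exactly.\<close>
  also have "\<dots> = (\<Sum>(w, i)\<in>{(w, i). w \<in> ?C \<and> i \<le> length w \<and> f (take i w) \<noteq> 0 \<and> g (drop i w) \<noteq> 0}.
      f (take i w) * g (drop i w) * word_image p w v)"
    by (rule sum.mono_neutral_right) (use C in auto)
  also have "\<dots> = (\<Sum>(u, w)\<in>?A \<times> ?B. f u * g w * word_image p (u @ w) v)"
    by (rule sum.reindex_bij_witness[of _ "\<lambda>(u, w). (u @ w, length u)" "\<lambda>(w, i). (take i w, drop i w)"])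
      (auto simp del: take_append drop_append simp: split)
  also have "\<dots> = (\<Sum>u\<in>?A. \<Sum>w\<in>?B. \<Sum>i\<in>{0..length v}.
      (f u * word_image p u (take i v)) * (g w * word_image p w (drop i v)))"
    unfolding sum.cartesian_product[symmetric]
    by (simp add: word_image_append fmul_def sum_distrib_left mult_ac)
  also have "\<dots> = (\<Sum>i\<in>{0..length v}. \<Sum>u\<in>?A. \<Sum>w\<in>?B.
      (f u * word_image p u (take i v)) * (g w * word_image p w (drop i v)))"
    by (subst sum.swap[of _ _ "{0..length v}"]) (intro sum.cong refl sum.swap)
  also have "\<dots> = fmul (substitution p f) (substitution p g) v"
    by (simp add: fmul_def substitution_def sum_product)
  finally show "substitution p (fmul f g) v = fmul (substitution p f) (substitution p g) v" .
qed

lemma substitution_fcomm: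
  assumes f: "finite {w. f w \<noteq> 0}" and g: "finite {w. g w \<noteq> 0}"
  shows "substitution p (fcomm f g) = fcomm (substitution p f) (substitution p g)"
proof -
  have "fcomm f g = fmul f g + fscale (-1) (fmul g f)"
    by (simp add: fcomm_def fscale_def fun_eq_iff)
  moreover have "finite {w. fscale (-1) (fmul g f) w \<noteq> 0}"
    using finite_support_fmul[OF g f] by (simp add: fscale_def)
  ultimately show ?thesis
    by (simp only: substitution_add finite_support_fmul assms substitution_scale substitution_fmul)
      (simp add: fcomm_def fscale_def fun_eq_iff)
qed

lemma substitution_letter: "substitution p (letter x) = fmul (p x) fone"
proof -
  have "{w. letter x w \<noteq> (0 :: 'b)} = {[x]}" by (auto simp: letter_def)
  then show ?thesis by (simp add: substitution_def letter_def)
qed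

lemma fmul_fone_right [simp]: "fmul f fone = f"
proof
  fix w show "fmul f fone w = f w"
    by (induction w arbitrary: f) (simp_all add: fone_def)
qed

text \<open>Stated for a set so that it applies by first-order unification: instantiating the predicate of
  \<open>free_lie.induct\<close> by unification eta-expands the Lie polynomials, which blocks simplification.\<close>
lemma free_lie_subset:
  fixes S :: "('x list \<Rightarrow> 'k::field) set"
  assumes "\<And>x. x \<in> X \<Longrightarrow> letter x \<in> S" and "0 \<in> S"
    and "\<And>f g. f \<in> free_lie X \<Longrightarrow> f \<in> S \<Longrightarrow> g \<in> free_lie X \<Longrightarrow> g \<in> S \<Longrightarrow> f + g \<in> S"
    and "\<And>f c. f \<in> free_lie X \<Longrightarrow> f \<in> S \<Longrightarrow> fscale c f \<in> S"
    and "\<And>f g. f \<in> free_lie X \<Longrightarrow> f \<in> S \<Longrightarrow> g \<in> free_lie X \<Longrightarrow> g \<in> S \<Longrightarrow> fcomm f g \<in> S"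
  shows "free_lie X \<subseteq> S"
proof
  fix f :: "'x list \<Rightarrow> 'k" assume "f \<in> free_lie X"
  then show "f \<in> S" using assms by (rule free_lie.induct[where P = "\<lambda>f. f \<in> S"])
qed

lemma finite_support_free_lie_subset: "free_lie X \<subseteq> {f. finite {w. f w \<noteq> 0}}"
proof (rule free_lie_subset, goal_cases gen zero add scale comm)
  case (gen x)
  have "{w. letter x w \<noteq> (0 :: 'b)} = {[x]}" by (auto simp: letter_def)
  then show ?case by simp
next
  case (add f g)
  have "{w. (f + g) w \<noteq> 0} \<subseteq> {w. f w \<noteq> 0} \<union> {w. g w \<noteq> 0}" by auto
  then show ?case unfolding mem_Collect_eq by (rule finite_subset) (use add in simp)
next
  case (scale f c)
  have "{w. fscale c f w \<noteq> 0} \<subseteq> {w. f w \<noteq> 0}" by (auto simp: fscale_def)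
  then show ?case unfolding mem_Collect_eq by (rule finite_subset) (use scale in simp)
next
  case (comm f g)
  have "{w. fcomm f g w \<noteq> 0} \<subseteq> {w. fmul f g w \<noteq> 0} \<union> {w. fmul g f w \<noteq> 0}"
    by (auto simp: fcomm_def)
  then show ?case unfolding mem_Collect_eq by (rule finite_subset) (use comm in \<open>simp add: finite_support_fmul\<close>)
qed simp

lemma finite_support_free_lie: "f \<in> free_lie X \<Longrightarrow> finite {w. f w \<noteq> 0}"
  using finite_support_free_lie_subset by blast

section \<open>Lie algebras with one-dimensional derived algebra\<close>

locale lie_alg =
  fixes s :: "'k::field \<Rightarrow> 'a::ab_group_add \<Rightarrow> 'a" and b :: "'a \<Rightarrow> 'a \<Rightarrow> 'a"
  assumes lie_algebra: "lie_algebra s b"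
begin

sublocale vector_space s
  using lie_algebra by (simp add: lie_algebra_def)

lemma br_add_left: "b (x + y) z = b x z + b y z"
  and br_add_right: "b z (x + y) = b z x + b z y"
  and br_scale_left: "b (s c x) z = s c (b x z)"
  and br_scale_right: "b z (s c x) = s c (b z x)"
  and br_self [simp]: "b x x = 0"
  and jacobi: "b x (b y z) + b y (b z x) + b z (b x y) = 0"
  using lie_algebra by (simp_all add: lie_algebra_def)

lemma br_zero_left [simp]: "b 0 z = 0"
  using br_add_left[of 0 0 z] by simp

lemma br_zero_right [simp]: "b z 0 = 0"
  using br_add_right[of z 0 0] by simp

lemma br_minus_left: "b (- x) z = - b x z"
  using br_add_left[of x "- x" z] by (simp add: eq_neg_iff_add_eq_0 add.commute)

lemma br_minus_right: "b z (- x) = - b z x"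
  using br_add_right[of z x "- x"] by (simp add: eq_neg_iff_add_eq_0 add.commute)

lemma br_diff_left: "b (x - y) z = b x z - b y z"
  using br_add_left[of x "- y" z] by (simp add: br_minus_left)

lemma br_diff_right: "b z (x - y) = b z x - b z y"
  using br_add_right[of z x "- y"] by (simp add: br_minus_right)

lemma br_anti: "b x y = - b y x"
  using br_self[of "x + y"] br_self[of x] br_self[of y]
  by (simp only: br_add_left br_add_right) (simp add: eq_neg_iff_add_eq_0 add.commute)

lemma br_sum_left: "b (sum f I) z = (\<Sum>i\<in>I. b (f i) z)"
  by (induction I rule: infinite_finite_induct) (simp_all add: br_add_left)

lemma br_sum_right: "b z (sum f I) = (\<Sum>i\<in>I. b z (f i))"
  by (induction I rule: infinite_finite_induct) (simp_all add: br_add_right)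

text \<open>Jacobi solved for a right-nested bracket, to reach left-normed ones.\<close>

lemma br_br: "b x (b y z) = b (b x y) z - b (b x z) y"
proof -
  have "b x (b y z) = - (b y (b z x) + b z (b x y))"
    using jacobi[of x y z] by (metis add.assoc eq_neg_iff_add_eq_0)
  also have "\<dots> = b (b x y) z - b (b x z) y"
    by (simp add: br_anti[of y] br_anti[of z x] br_anti[of z "b x y"] br_minus_left br_minus_right)
  finally show ?thesis .
qed

lemma jacobi': "b (b x y) z + b (b y z) x + b (b z x) y = 0"
  using br_br[of x y z] br_anti[of x "b y z"] by (simp add: br_anti[of z x] br_minus_left)
    (metis add.commute add_diff_eq diff_add_cancel diff_self group_cancel.add1 minus_add_cancel)

text \<open>The bracket is linear in each slot, so \<open>G\<close> is replaced by its span one slot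
  at a time.\<close>

lemma triple_br_span:
  assumes S: "subspace S" and G: "\<And>f g h. f \<in> G \<Longrightarrow> g \<in> G \<Longrightarrow> h \<in> G \<Longrightarrow> b (b f g) h \<in> S"
    and "f \<in> span G" "g \<in> span G" "h \<in> span G"
  shows "b (b f g) h \<in> S"
proof -
  have sub: "subspace {x. b (b x g) h \<in> S}" "subspace {x. b (b f x) h \<in> S}" "subspace {x. b (b f g) x \<in> S}"
    for f g h
    using S by (auto simp: subspace_def br_add_left br_add_right br_scale_left br_scale_right)
  have 1: "b (b f g) h \<in> S" if "f \<in> span G" "g \<in> G" "h \<in> G" for f g h
    using span_induct[OF that(1) sub(1)] G that by blast
  have 2: "b (b f g) h \<in> S" if "f \<in> span G" "g \<in> span G" "h \<in> G" for f g h
    using span_induct[OF that(2) sub(2)] 1 that by blast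
  show ?thesis
    using span_induct[OF assms(5) sub(3)] 2 assms by blast
qed

end

section \<open>Dimensions of quotients and one-dimensional subspaces\<close>

context vector_space
begin

text \<open>\<open>quot_dim\<close> speaks of a set of vectors, but the spanning elements come as an
  indexed family. Independence modulo \<open>N\<close> makes the family injective, so the
  cardinality carries over.\<close>

lemma quot_dimI:
  assumes "finite I" "card I = k" "v ` I \<subseteq> M" "M \<subseteq> span (v ` I \<union> N)" "subspace N"
    and indep: "\<And>c. (\<Sum>i\<in>I. scale (c i) (v i)) \<in> N \<Longrightarrow> \<forall>i\<in>I. c i = 0"
  shows "quot_dim scale M N k"
proof -
  have inj: "inj_on v I"
  proof (rule inj_onI, rule ccontr)
    fix i j assume ij: "i \<in> I" "j \<in> I" "v i = v j" "i \<noteq> j"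
    \<comment> \<open>Coefficients of \<open>v i - v j\<close>, a nontrivial relation when the two
      vectors agree.\<close>
    define c where "c = (\<lambda>l. if l = i then 1 else if l = j then - 1 else 0 :: 'a)"
    have "(\<Sum>l\<in>I. scale (c l) (v l)) = (\<Sum>l\<in>{i, j}. scale (c l) (v l))"
      using ij \<open>finite I\<close> by (intro sum.mono_neutral_right) (auto simp: c_def)
    also have "\<dots> = 0" using ij by (simp add: c_def)
    finally have "\<forall>l\<in>I. c l = 0" using indep \<open>subspace N\<close> subspace_0 by metis
    then show False using ij by (auto simp: c_def)
  qed
  have "\<forall>x\<in>v ` I. c x = 0" if "(\<Sum>x\<in>v ` I. scale (c x) x) \<in> N" for c
    using that indep[of "c \<circ> v"] by (simp add: sum.reindex[OF inj])
  then show ?thesis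
    unfolding quot_dim_def using assms card_image[OF inj] by (intro exI[of _ "v ` I"]) auto
qed

lemma dim_1_subset_span:
  assumes "dim S = 1" "z \<in> S" "z \<noteq> 0"
  shows "S \<subseteq> span {z}"
proof -
  obtain B where B: "B \<subseteq> S" "S \<subseteq> span B" "card B = dim S"
    by (rule basis_exists)
  then obtain w where w: "B = {w}" using assms(1) card_1_singletonE by metis
  then obtain c where c: "z = scale c w" using B assms(2) by (auto simp: span_singleton)
  then have "w = scale (inverse c) z" using assms(3) by auto
  then have "w \<in> span {z}" by (metis span_base span_scale singletonI)
  then have "span B \<subseteq> span {z}" using w by (simp add: span_minimal)
  then show ?thesis using B by blast
qed

end

text \<open>A basis adapted to the alternating form \<open>\<omega>\<close> given by the bracket:
  \<open>e 0\<close> and \<open>e 1\<close> are a hyperbolic pair, and the other basis vectors are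
  orthogonal to both.\<close>

locale heis_basis = lie_alg s b
  for s :: "'k::field \<Rightarrow> 'a::ab_group_add \<Rightarrow> 'a" and b :: "'a \<Rightarrow> 'a \<Rightarrow> 'a" +
  fixes e :: "nat \<Rightarrow> 'a" and z :: 'a and d :: nat and \<omega> :: "'a \<Rightarrow> 'a \<Rightarrow> 'k"
  assumes d2: "2 \<le> d"
    and coords: "\<exists>a c. x = (\<Sum>i<d. s (a i) (e i)) + s c z"
    and coords_0: "(\<Sum>i<d. s (a i) (e i)) + s c z = 0 \<Longrightarrow> (\<forall>i<d. a i = 0) \<and> c = 0"
    and br_eq: "b x y = s (\<omega> x y) z"
    and central: "b x z = 0"
    and br_01: "b (e 0) (e 1) = z"
    and br_0: "2 \<le> i \<Longrightarrow> i < d \<Longrightarrow> b (e 0) (e i) = 0"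
    and br_1: "2 \<le> i \<Longrightarrow> i < d \<Longrightarrow> b (e 1) (e i) = 0"

text \<open>A plane spanned by \<open>u\<close>, \<open>v\<close> in \<open>H\<close> with nonzero
  bracket is nondegenerate for \<open>\<omega>\<close>, so \<open>L\<close> is its direct sum with
  the common centralizer \<open>W\<close> of \<open>u\<close> and \<open>v\<close>, and the rest of
  the basis is drawn from \<open>W\<close>. Whether \<open>W\<close> is abelian separates
  \<open>m = 1\<close> from \<open>m > 1\<close>.\<close>

lemma heis_plus_abelian_basis:
  assumes lie: "lie_algebra s b"
    and fin: "finite B" "module.span s B = UNIV"
    and dim: "vector_space.dim s (UNIV :: 'a::ab_group_add set) = n"
    and dim1: "vector_space.dim s (lcs s b 1) = 1"
    and m: "m \<ge> 1" and heis: "heis_plus_abelian s b m k"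
  obtains e z d \<omega> where "heis_basis s b e z d \<omega>" "n = Suc d"
    "m = 1 \<longrightarrow> (\<forall>i j. 2 \<le> i \<longrightarrow> i < d \<longrightarrow> 2 \<le> j \<longrightarrow> j < d \<longrightarrow> b (e i) (e j) = 0)"
    "m > 1 \<longrightarrow> (\<exists>w w'. b w w' = z \<and> b w (e 0) = 0 \<and> b w' (e 0) = 0
       \<and> b w (e 1) = 0 \<and> b w' (e 1) = 0)"
proof -
  interpret lie_alg s b using lie by unfold_locales
  obtain Bas where Bas: "Bas \<subseteq> B" "independent Bas" "B \<subseteq> span Bas"
    by (rule maximal_independent_subset)
  have "span B \<subseteq> span Bas" by (rule span_minimal) (use Bas in simp_all)
  then have "span Bas = UNIV" using fin by auto
  interpret fd: finite_dimensional_vector_space s Bas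
    using Bas \<open>span Bas = UNIV\<close> fin finite_subset by unfold_locales auto
  obtain H A where HA: "lie_ideal s b H" "lie_ideal s b A" "H \<inter> A = {0}"
      "{h + a | h a. h \<in> H \<and> a \<in> A} = UNIV"
    and Hs: "heisenberg_sub s b H m" and Aab: "\<And>x y. x \<in> A \<Longrightarrow> y \<in> A \<Longrightarrow> b x y = 0"
    using heis unfolding heis_plus_abelian_def by blast
  have subH: "subspace H" and brH: "\<And>x y. x \<in> H \<Longrightarrow> y \<in> H \<Longrightarrow> b x y \<in> H"
    and dimH: "dim H = 2 * m + 1" and cenH: "brk s b H H = lie_centre b H"
    and dimHH: "dim (brk s b H H) = 1"
    using Hs by (auto simp: heisenberg_sub_def)
  have HA0: "b h a = 0" "b a h = 0" if "h \<in> H" "a \<in> A" for h a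
  proof -
    have "b h a \<in> H" "b a h \<in> A" using HA that by (auto simp: lie_ideal_def)
    moreover from this(2) have "b h a \<in> A"
      using HA(2) br_anti[of h a] subspace_neg unfolding lie_ideal_def by metis
    ultimately show "b h a = 0" using HA(3) by auto
    then show "b a h = 0" using br_anti[of a h] by simp
  qed
  have dec: "\<exists>h a. x = h + a \<and> h \<in> H \<and> a \<in> A" for x
    using HA(4) by blast
  have "\<exists>u\<in>H. \<exists>v\<in>H. b u v \<noteq> 0"
  proof (rule ccontr)
    assume "\<not> ?thesis"
    then have "brk s b H H \<subseteq> span {}"
      unfolding brk_def by (intro span_minimal) auto
    then have "dim (brk s b H H) \<le> card ({} :: 'a set)" by (rule dim_le_card) simp
    then show False using dimHH by simp
  qed
  then obtain u v where uv: "u \<in> H" "v \<in> H" "b u v \<noteq> 0" by blast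
  define z where "z = b u v"
  have z0: "z \<noteq> 0" using uv by (simp add: z_def)
  have zHH: "z \<in> brk s b H H"
    unfolding z_def brk_def using uv by (intro span_base) auto
  then have zcen: "z \<in> H" "\<And>h. h \<in> H \<Longrightarrow> b z h = 0"
    using cenH by (auto simp: lie_centre_def)
  have central: "b z x = 0" "b x z = 0" for x
  proof -
    obtain h a where "x = h + a" "h \<in> H" "a \<in> A" using dec by blast
    then show "b z x = 0" using zcen HA0 by (simp add: br_add_right)
    then show "b x z = 0" using br_anti[of x z] by simp
  qed
  have zz: "b x y \<in> brk s b UNIV UNIV" for x y
    unfolding brk_def by (intro span_base) auto
  have "brk s b UNIV UNIV \<subseteq> span {z}"
    using dim_1_subset_span[of "brk s b UNIV UNIV" z] dim1 z0 zz by (simp add: z_def)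
  then have "\<exists>c. b x y = s c z" for x y
    using zz[of x y] by (auto simp: span_singleton)
  then obtain \<omega> where \<omega>: "\<And>x y. b x y = s (\<omega> x y) z" by metis
  define W where "W = {x. b u x = 0 \<and> b v x = 0}"
  have subW: "subspace W"
    by (auto simp: W_def subspace_def br_add_right br_scale_right)
  \<comment> \<open>Projection onto \<open>W\<close> along the plane of \<open>u\<close> and
    \<open>v\<close>; the signs come from \<open>[v,u] = -z\<close>.\<close>
  define pr where "pr x = x - s (\<omega> u x) v + s (\<omega> v x) u" for x
  have bvu: "b v u = - z" using br_anti[of v u] by (simp add: z_def)
  have prW: "pr x \<in> W" for x
    using \<omega>[of u x] \<omega>[of v x] bvu
    by (simp add: W_def pr_def br_add_right br_diff_right br_scale_right z_def[symmetric])
  have prH: "pr x \<in> H" if "x \<in> H" for x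
    unfolding pr_def using that uv subH by (simp add: subspace_add subspace_diff subspace_scale)
  have xpr: "x = pr x + s (\<omega> u x) v - s (\<omega> v x) u" for x
    by (simp add: pr_def)
  have zW: "z \<in> W" using central by (simp add: W_def)
  have W0: "b x u = 0" "b x v = 0" if "x \<in> W" for x
    using that br_anti[of x u] br_anti[of x v] by (auto simp: W_def)
  obtain C where C: "{z} \<subseteq> C" "C \<subseteq> W" "independent C" "W \<subseteq> span C"
    using maximal_independent_subset_extend[of "{z}" W] zW z0 by auto
  have finC: "finite C" using C(3) by (rule fd.finiteI_independent)
  have spanC: "span C = W" using C subW by (simp add: span_minimal subset_antisym)
  define D where "D = C - {z}"
  have CD: "C = insert z D" "z \<notin> D" "finite D" using C finC by (auto simp: D_def)
  obtain f where f: "bij_betw f {..<card D} D"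
    using ex_bij_betw_nat_finite[OF CD(3)] by (auto simp: atLeast0LessThan)
  \<comment> \<open>\<open>u\<close> and \<open>v\<close> come first; the basis of \<open>W\<close>
    without \<open>z\<close> follows, shifted by two.\<close>
  define e where "e = (\<lambda>i. if i = 0 then u else if i = 1 then v else f (i - 2))"
  define d where "d = Suc (Suc (card D))"
  have eW: "e i \<in> W" if "2 \<le> i" "i < d" for i
  proof -
    have "f (i - 2) \<in> D" using f that by (auto simp: bij_betw_def d_def)
    then show ?thesis using C CD that by (auto simp: e_def)
  qed
  have sum_e: "(\<Sum>i<d. s (a i) (e i)) = s (a 0) u + s (a 1) v + (\<Sum>i<card D. s (a (Suc (Suc i))) (f i))" for a
    by (simp add: d_def e_def sum.lessThan_Suc_shift add.assoc del: sum.lessThan_Suc)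
  have sum_f: "(\<Sum>i<card D. s (a (f i)) (f i)) = (\<Sum>x\<in>D. s (a x) x)" for a
    by (rule sum.reindex_bij_betw[OF f])
  have coords: "\<exists>a c. x = (\<Sum>i<d. s (a i) (e i)) + s c z" for x
  proof -
    have "pr x \<in> span C" using prW spanC by simp
    then obtain g where "pr x = (\<Sum>y\<in>C. s (g y) y)"
      using span_finite[OF finC] by auto
    then have g: "pr x = s (g z) z + (\<Sum>i<card D. s (g (f i)) (f i))"
      using CD by (simp add: sum_f)
    show ?thesis
      by (rule exI[of _ "\<lambda>i. if i = 0 then - \<omega> v x else if i = 1 then \<omega> u x else g (f (i - 2))"],
          rule exI[of _ "g z"])
        (subst xpr[of x], simp add: g sum_e)
  qed
  have coords_0: "(\<forall>i<d. a i = 0) \<and> c = 0" if eq: "(\<Sum>i<d. s (a i) (e i)) + s c z = 0" for a c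
  proof -
    let ?t = "\<Sum>i<card D. s (a (Suc (Suc i))) (f i)"
    have "f i \<in> W" if "i < card D" for i
      using eW[of "Suc (Suc i)"] that by (simp add: e_def d_def)
    then have t: "?t \<in> W" using subW by (intro subspace_sum) (auto intro: subspace_scale)
    have eq': "s (a 0) u + s (a 1) v + ?t + s c z = 0" using eq by (simp add: sum_e)
    \<comment> \<open>Bracketing with \<open>u\<close> kills \<open>W\<close> and \<open>u\<close>,
      isolating the coefficient of \<open>v\<close>; below, \<open>v\<close> does the same for
      \<open>u\<close>.\<close>
    have "b u (s (a 0) u + s (a 1) v + ?t + s c z) = s (a 1) z"
      using t central by (simp add: br_add_right br_scale_right W_def z_def)
    then have a1: "a 1 = 0" using eq' z0 by simp
    have "b v (s (a 0) u + s (a 1) v + ?t + s c z) = s (a 0) (- z)"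
      using t central bvu by (simp add: br_add_right br_scale_right W_def)
    then have a0: "a 0 = 0" using eq' z0 by simp
    \<comment> \<open>The coefficients of \<open>z\<close> and of the \<open>f i\<close>, read as
      one function on the basis \<open>C\<close> of \<open>W\<close>.\<close>
    define g where "g y = (if y = z then c else a (Suc (Suc (inv_into {..<card D} f y))))" for y
    have gf: "g (f i) = a (Suc (Suc i))" if "i < card D" for i
    proof -
      have "f i \<in> D" "inv_into {..<card D} f (f i) = i"
        using f that by (auto simp: bij_betw_def)
      then show ?thesis using CD by (auto simp: g_def)
    qed
    have "(\<Sum>y\<in>C. s (g y) y) = s c z + ?t"
      using CD gf by (simp add: sum_f[symmetric]) (simp add: g_def)
    also have "\<dots> = 0" using eq' a0 a1 by (simp add: add.commute)
    finally have g0: "\<forall>y\<in>C. g y = 0"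
      using C(3) finC unfolding independent_explicit_finite_subsets by blast
    then have c: "c = 0" using C by (auto simp: g_def)
    have "a i = 0" if "i < d" for i
    proof (cases "i < 2")
      case True
      then show ?thesis using a0 a1 by (auto simp: less_Suc_eq numeral_2_eq_2)
    next
      case False
      then have i: "i - 2 < card D" "Suc (Suc (i - 2)) = i" using that by (auto simp: d_def)
      then have "f (i - 2) \<in> C" using f CD by (auto simp: bij_betw_def)
      then show ?thesis using g0 gf[OF i(1)] i by simp
    qed
    then show ?thesis using c by simp
  qed
  have "n = Suc d"
  proof -
    have v: "v \<notin> span C" using spanC uv by (simp add: W_def)
    have "subspace {x. b v x = 0}" by (auto simp: subspace_def br_add_right br_scale_right)
    then have "span (insert v C) \<subseteq> {x. b v x = 0}"
      using C by (intro span_minimal) (auto simp: W_def)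
    then have u: "u \<notin> span (insert v C)" using bvu z0 by auto
    have ind: "independent (insert u (insert v C))"
      using u v C(3) by (simp add: independent_insert)
    have "UNIV \<subseteq> span (insert u (insert v C))"
    proof
      fix x
      have "pr x \<in> span (insert u (insert v C))"
        using prW[of x] spanC span_mono[of C "insert u (insert v C)"] by blast
      then show "x \<in> span (insert u (insert v C))"
        by (subst xpr[of x], intro span_add span_diff span_scale) (simp_all add: span_base)
    qed
    then have "dim (UNIV :: 'a set) = card (insert u (insert v C))"
      by (intro dim_unique[OF _ _ ind]) auto
    also have "\<dots> = Suc d"
    proof -
      have "u \<notin> insert v C" "v \<notin> C" using u v span_base by blast+
      moreover have "card C = Suc (card D)" using CD by simp
      ultimately show ?thesis using finC by (simp add: d_def)
    qed
    finally show ?thesis using dim by simp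
  qed
  \<comment> \<open>For \<open>m = 1\<close> the independent \<open>u\<close>, \<open>v\<close>,
    \<open>z\<close> exhaust the three-dimensional \<open>H\<close>. The \<open>H\<close>-part of an
    element of \<open>W\<close> commutes with all three, and the \<open>A\<close>-parts contribute
    nothing.\<close>
  have m1: "b x y = 0" if "m = 1" "x \<in> W" "y \<in> W" for x y
  proof -
    have v: "v \<notin> span {z}"
      using span_minimal[of "{z}" W] zW subW uv by (auto simp: W_def)
    have "subspace {x. b v x = 0}" by (auto simp: subspace_def br_add_right br_scale_right)
    then have "span {v, z} \<subseteq> {x. b v x = 0}"
      using central by (intro span_minimal) auto
    then have u: "u \<notin> span {v, z}" using bvu z0 by auto
    have ind: "independent {u, v, z}"
      using u v z0 by (simp add: independent_insert)
    have "u \<noteq> v" "u \<noteq> z" "v \<noteq> z" using u v span_base by blast+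
    then have "card {u, v, z} = 3" by simp
    then have H: "H \<subseteq> span {u, v, z}"
      using that dimH uv zcen by (intro fd.card_ge_dim_independent[OF _ ind]) auto
    obtain h a where h: "x = h + a" "h \<in> H" "a \<in> A" using dec by blast
    obtain h' a' where h': "y = h' + a'" "h' \<in> H" "a' \<in> A" using dec by blast
    have xy: "b x y = b h h'" using h h' HA0 Aab by (simp add: br_add_left br_add_right)
    have "b u h' = 0" "b v h' = 0"
      using that(3) h' uv HA0 by (auto simp: W_def br_add_right)
    then have "{u, v, z} \<subseteq> {x. b x h' = 0}" using central by auto
    moreover have "subspace {x. b x h' = 0}" by (auto simp: subspace_def br_add_left br_scale_left)
    ultimately have "span {u, v, z} \<subseteq> {x. b x h' = 0}" by (rule span_minimal)
    then show ?thesis using H h xy by auto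
  qed
  \<comment> \<open>Otherwise \<open>W\<close> is abelian, so \<open>pr h\<close> for
    \<open>h\<close> in \<open>H\<close> is central and thus a multiple of \<open>z\<close>. Then
    \<open>u\<close>, \<open>v\<close>, \<open>z\<close> span \<open>H\<close>, whose dimension
    exceeds 3.\<close>
  have m2: "\<exists>w w'. b w w' = z \<and> b w u = 0 \<and> b w' u = 0 \<and> b w v = 0 \<and> b w' v = 0" if "m > 1"
  proof (rule ccontr)
    assume no: "\<not> ?thesis"
    have W: "b x y = 0" if "x \<in> W" "y \<in> W" for x y
    proof (rule ccontr)
      assume "b x y \<noteq> 0"
      then have "\<omega> x y \<noteq> 0" using \<omega>[of x y] by auto
      then have "b (s (inverse (\<omega> x y)) x) y = z" using \<omega>[of x y] by (simp add: br_scale_left)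
      moreover have "s (inverse (\<omega> x y)) x \<in> W" using subW that subspace_scale by blast
      ultimately show False using no W0 that by blast
    qed
    have "H \<subseteq> span {u, v, z}"
    proof
      fix h assume h: "h \<in> H"
      have "b (pr h) k = 0" for k
        using W[OF prW prW] W0[OF prW]
        by (subst xpr[of k]) (simp add: br_add_right br_diff_right br_scale_right)
      then have "pr h \<in> brk s b H H" using cenH prH[OF h] by (simp add: lie_centre_def)
      then have "pr h \<in> span {z}" using dim_1_subset_span[OF dimHH zHH z0] by blast
      then have "pr h \<in> span {u, v, z}" using span_mono[of "{z}" "{u, v, z}"] by auto
      then show "h \<in> span {u, v, z}"
        by (subst xpr[of h], intro span_add span_diff span_scale) (simp_all add: span_base)
    qed
    then have "dim H \<le> card {u, v, z}" by (intro dim_le_card) auto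
    also have "\<dots> \<le> 3" by (simp add: card_insert_if)
    finally show False using dimH that by simp
  qed
  have e01: "e 0 = u" "e 1 = v" by (simp_all add: e_def)
  have "heis_basis s b e z d \<omega>"
  proof unfold_locales
    show "b (e 0) (e 1) = z" using e01 by (simp add: z_def)
    show "b (e 0) (e i) = 0" "b (e 1) (e i) = 0" if "2 \<le> i" "i < d" for i
      using eW[OF that] unfolding e01 W_def by simp_all
  qed (fact coords coords_0 \<omega> central(2) | simp add: d_def)+
  then show ?thesis
    using \<open>n = Suc d\<close> m1 m2 eW e01 by (intro that[of e z d \<omega>]) simp_all
qed

section \<open>A spanning set of the 2-nilpotent multiplier\<close>

text \<open>All functions on words form one ambient Lie algebra, in which \<open>F\<close> and its
  ideals are subspaces.\<close>

interpretation fl: lie_alg "fscale :: 'k::field \<Rightarrow> ('x list \<Rightarrow> 'k) \<Rightarrow> _" fcomm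
  by unfold_locales (rule lie_algebra_fcomm)

lemma subspace_free_lie: "fl.subspace (free_lie X)"
  by (simp add: fl.subspace_def free_lie.intros)

lemma fbrk_free_lie: "fbrk (free_lie X) (free_lie X) \<subseteq> free_lie X"
  unfolding fbrk_def using subspace_free_lie
  by (intro fl.span_minimal) (auto intro: free_lie.comm)

lemma fbrk_base: "u \<in> U \<Longrightarrow> v \<in> V \<Longrightarrow> fcomm u v \<in> fbrk U V"
  unfolding fbrk_def by (intro fl.span_base) blast

lemma subspace_fbrk: "fl.subspace (fbrk U V)"
  unfolding fbrk_def by (rule fl.subspace_span)

lemma fbrk_minimal:
  assumes "fl.subspace S" "\<And>u v. u \<in> U \<Longrightarrow> v \<in> V \<Longrightarrow> fcomm u v \<in> S"
  shows "fbrk U V \<subseteq> S"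
  unfolding fbrk_def using assms by (intro fl.span_minimal) auto

text \<open>Bracketing with a fixed \<open>w\<close> is linear, so the inner span is checked on its
  generators.\<close>

lemma fbrk_fbrk_minimal:
  assumes S: "fl.subspace S"
    and "\<And>u v w. u \<in> U \<Longrightarrow> v \<in> V \<Longrightarrow> w \<in> W \<Longrightarrow> fcomm (fcomm u v) w \<in> S"
  shows "fbrk (fbrk U V) W \<subseteq> S"
proof (rule fbrk_minimal[OF S])
  fix u w assume u: "u \<in> fbrk U V" and w: "w \<in> W"
  have "fl.subspace {u. fcomm u w \<in> S}"
    using S by (auto simp: fl.subspace_def fl.br_add_left fl.br_scale_left)
  then have "fbrk U V \<subseteq> {u. fcomm u w \<in> S}"
    using assms(2) w by (intro fbrk_minimal) auto
  then show "fcomm u w \<in> S" using u by blast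
qed

text \<open>Pairs \<open>(i, j)\<close> with \<open>(j, i)\<close>, as suits the expansion of an
  alternating form.\<close>

lemma sum_square_eq_sum_triangle:
  fixes h :: "nat \<Rightarrow> nat \<Rightarrow> 'b::comm_monoid_add"
  shows "(\<Sum>i<n. \<Sum>j<n. h i j) = (\<Sum>j<n. \<Sum>i<j. h i j + h j i) + (\<Sum>i<n. h i i)"
  by (induction n) (simp_all add: sum.distrib add_ac)

text \<open>Indices of the basic (Hall) commutators of weight three; their number is the dimension
  of the degree 3 part of the free Lie algebra on \<open>d\<close> letters.\<close>

definition basic_triples :: "nat \<Rightarrow> (nat \<times> nat \<times> nat) set" where
  "basic_triples d = {(i, j, k). i < d \<and> j < i \<and> j \<le> k \<and> k < d}"

lemma finite_basic_triples: "finite (basic_triples d)"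
  by (rule finite_subset[of _ "{..<d} \<times> {..<d} \<times> {..<d}"]) (auto simp: basic_triples_def)

text \<open>For fixed \<open>j\<close> there are \<open>d - 1 - j\<close> choices of
  \<open>i\<close> and \<open>d - j\<close> of \<open>k\<close>; put
  \<open>l = d - 1 - j\<close>.\<close>

lemma card_basic_triples: "card (basic_triples d) = Suc d * d * (d - 1) div 3"
proof -
  have "bij_betw (\<lambda>(j, i, k). (i, j, k)) (SIGMA j:{..<d}. {j<..<d} \<times> {j..<d}) (basic_triples d)"
    by (rule bij_betw_byWitness[where f' = "\<lambda>(i, j, k). (j, i, k)"]) (auto simp: basic_triples_def)
  then have "card (basic_triples d) = (\<Sum>j<d. (d - Suc j) * Suc (d - Suc j))"
    by (simp add: bij_betw_same_card[symmetric] card_cartesian_product Suc_diff_Suc)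
  also have "\<dots> = (\<Sum>l<d. l * Suc l)"
    by (rule sum.nat_diff_reindex)
  finally have *: "card (basic_triples d) = (\<Sum>l<d. l * Suc l)" .
  have "3 * (\<Sum>l<d. l * Suc l) = Suc d * d * (d - 1)"
  proof (induction d)
    case (Suc d)
    then show ?case by (cases d) (simp_all add: algebra_simps)
  qed simp
  then show ?thesis using * by simp
qed

section \<open>Computation in \<open>F\<close> modulo \<open>[[R,F],F]\<close>\<close>

locale heis_presentation = heis_basis s b e z d \<omega>
  for s :: "'k::field \<Rightarrow> 'a::ab_group_add \<Rightarrow> 'a" and b e z d \<omega> +
  fixes X :: "'x set" and phi :: "('x list \<Rightarrow> 'k) \<Rightarrow> 'a"
  assumes presentation: "free_presentation s b X phi"
begin

abbreviation "F \<equiv> free_lie X :: ('x list \<Rightarrow> 'k) set"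
abbreviation "R \<equiv> pres_R X phi"
abbreviation "D \<equiv> mult2_den X phi"

lemma phi_add: "f \<in> F \<Longrightarrow> g \<in> F \<Longrightarrow> phi (f + g) = phi f + phi g"
  and phi_comm: "f \<in> F \<Longrightarrow> g \<in> F \<Longrightarrow> phi (fcomm f g) = b (phi f) (phi g)"
  and phi_scale: "f \<in> F \<Longrightarrow> phi (fscale c f) = s c (phi f)"
  and phi_surj: "phi ` F = UNIV"
  using presentation by (auto simp: free_presentation_def)

lemma phi_0: "phi 0 = 0"
  using phi_scale[of 0 0] free_lie.zero[of X] by simp

lemma phi_diff: "f \<in> F \<Longrightarrow> g \<in> F \<Longrightarrow> phi (f - g) = phi f - phi g"
  using phi_add[of "f - g" g] fl.subspace_diff[OF subspace_free_lie, of f X g] by simp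

lemma phi_sum: "(\<And>i. i \<in> I \<Longrightarrow> f i \<in> F) \<Longrightarrow> phi (sum f I) = (\<Sum>i\<in>I. phi (f i))"
  by (induction I rule: infinite_finite_induct)
    (simp_all add: phi_0 phi_add fl.subspace_sum[OF subspace_free_lie])

lemma central': "b z x = 0"
  using br_anti[of z x] central[of x] by simp

lemma z_neq_0: "z \<noteq> 0"
  using coords_0[of "\<lambda>_. 0" 1] by auto

lemma R_subset: "R \<subseteq> F"
  by (auto simp: pres_R_def)

lemma subspace_R: "fl.subspace R"
  using subspace_free_lie[of X]
  by (auto simp: fl.subspace_def pres_R_def phi_0 phi_add phi_scale)

lemma subspace_D: "fl.subspace D"
  unfolding mult2_den_def by (rule subspace_fbrk)

lemma D_left: "r \<in> R \<Longrightarrow> f \<in> F \<Longrightarrow> g \<in> F \<Longrightarrow> fcomm (fcomm r f) g \<in> D"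
  unfolding mult2_den_def by (intro fbrk_base)

lemma D_middle: "r \<in> R \<Longrightarrow> f \<in> F \<Longrightarrow> g \<in> F \<Longrightarrow> fcomm (fcomm f r) g \<in> D"
  using fl.subspace_neg[OF subspace_D D_left[of r f g]]
  by (simp add: fl.br_anti[of f r] fl.br_minus_left)

lemma D_right: "r \<in> R \<Longrightarrow> f \<in> F \<Longrightarrow> g \<in> F \<Longrightarrow> fcomm r (fcomm f g) \<in> D"
  unfolding fl.br_br by (intro fl.subspace_diff[OF subspace_D] D_left)

lemma D_right': "r \<in> R \<Longrightarrow> f \<in> F \<Longrightarrow> g \<in> F \<Longrightarrow> fcomm (fcomm f g) r \<in> D"
  using fl.subspace_neg[OF subspace_D D_right[of r f g]]
  by (simp add: fl.br_anti[of "fcomm f g" r])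

text \<open>\<open>L^2\<close> is spanned by the central \<open>z\<close>, so \<open>F^3\<close>
  lies in \<open>R\<close>.\<close>

lemma mult2_num_eq: "mult2_num X phi = fbrk (fbrk F F) F"
proof -
  have "fbrk (fbrk F F) F \<subseteq> R"
  proof (rule fbrk_fbrk_minimal[OF subspace_R])
    fix f g h assume "f \<in> F" "g \<in> F" "h \<in> F"
    then show "fcomm (fcomm f g) h \<in> R"
      by (simp add: pres_R_def phi_comm free_lie.comm br_eq[of "phi f"] br_scale_left central')
  qed
  then show ?thesis by (auto simp: mult2_num_def)
qed

lemma mult2_num_comm:
  assumes "u \<in> mult2_num X phi" "v \<in> mult2_num X phi"
  shows "fcomm u v \<in> D"
proof -
  have u: "u \<in> R" using assms by (simp add: mult2_num_def)
  have "fl.subspace {v. fcomm u v \<in> D}"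
    using subspace_D by (auto simp: fl.subspace_def fl.br_add_right fl.br_scale_right)
  then have "fbrk (fbrk F F) F \<subseteq> {v. fcomm u v \<in> D}"
    by (rule fbrk_minimal) (use u D_right fbrk_free_lie in blast)
  then show ?thesis using assms mult2_num_eq by blast
qed

definition lift :: "'a \<Rightarrow> 'x list \<Rightarrow> 'k" where
  "lift x = (SOME f. f \<in> F \<and> phi f = x)"

lemma lift: "lift x \<in> F" "phi (lift x) = x"
proof -
  have "\<exists>f. f \<in> F \<and> phi f = x" using phi_surj by (metis UNIV_I imageE)
  from someI_ex[OF this] show "lift x \<in> F" "phi (lift x) = x"
    by (simp_all add: lift_def)
qed

abbreviation el :: "nat \<Rightarrow> 'x list \<Rightarrow> 'k" where
  "el i \<equiv> lift (e i)"

text \<open>A lift of \<open>z\<close> that is itself a bracket, unlike \<open>lift z\<close>: thus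
  \<open>D_right\<close> puts \<open>[r, zl]\<close> into \<open>D\<close> for \<open>r\<close> in
  \<open>R\<close>.\<close>

definition zl :: "'x list \<Rightarrow> 'k" where
  "zl = fcomm (el 0) (el 1)"

lemma zl: "zl \<in> F" "phi zl = z"
  using br_01 by (simp_all add: zl_def free_lie.comm lift phi_comm)

text \<open>Subtracting the lifts weighted by the coordinates of \<open>phi f\<close> leaves an
  element of \<open>R\<close>.\<close>

lemma F_subset_span: "F \<subseteq> fl.span (el ` {..<d} \<union> {zl} \<union> R)"
proof
  fix f assume f: "f \<in> F"
  obtain a c where ac: "phi f = (\<Sum>i<d. s (a i) (e i)) + s c z" using coords by blast
  define g where "g = (\<Sum>i<d. fscale (a i) (el i)) + fscale c zl"
  have gF: "g \<in> F" unfolding g_def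
    by (intro free_lie.add fl.subspace_sum[OF subspace_free_lie] free_lie.scale lift zl)
  have "phi g = phi f"
    unfolding g_def ac
    by (simp add: phi_add phi_sum phi_scale lift zl free_lie.scale fl.subspace_sum[OF subspace_free_lie])
  then have "f - g \<in> R"
    using f gF fl.subspace_diff[OF subspace_free_lie] by (simp add: pres_R_def phi_diff)
  then have "f - g \<in> fl.span (el ` {..<d} \<union> {zl} \<union> R)" by (intro fl.span_base) simp
  moreover have "g \<in> fl.span (el ` {..<d} \<union> {zl} \<union> R)"
    unfolding g_def by (intro fl.span_add fl.span_sum fl.span_scale fl.span_base) auto
  ultimately have "(f - g) + g \<in> fl.span (el ` {..<d} \<union> {zl} \<union> R)" by (rule fl.span_add)
  then show "f \<in> fl.span (el ` {..<d} \<union> {zl} \<union> R)" by simp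
qed

lemma comm_eq_zl: "f \<in> F \<Longrightarrow> g \<in> F \<Longrightarrow> b (phi f) (phi g) = s c z \<Longrightarrow> fcomm f g - fscale c zl \<in> R"
  using fl.subspace_diff[OF subspace_free_lie[of X], of "fcomm f g" "fscale c zl"]
  by (simp add: pres_R_def phi_diff phi_comm phi_scale free_lie.comm free_lie.scale zl)

text \<open>Modulo \<open>R\<close>, \<open>[f,g]\<close> is a multiple of \<open>zl\<close>, and
  \<open>[zl,zl] = 0\<close>.\<close>

lemma comm_zl_D:
  assumes "f \<in> F" "g \<in> F"
  shows "fcomm (fcomm f g) zl \<in> D"
proof -
  define r where "r = fcomm f g - fscale (\<omega> (phi f) (phi g)) zl"
  have "r \<in> R" unfolding r_def using assms br_eq by (intro comm_eq_zl)
  then have "fcomm r zl \<in> D" using D_right lift by (simp add: zl_def)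
  then show ?thesis by (simp add: r_def fl.br_diff_left fl.br_scale_left)
qed

text \<open>By Jacobi the difference is \<open>[zl,[f,g]]\<close>, which \<open>comm_zl_D\<close>
  covers up to sign.\<close>

lemma zl_sym:
  assumes "f \<in> F" "g \<in> F"
  shows "fcomm (fcomm zl f) g - fcomm (fcomm zl g) f \<in> D"
  using fl.subspace_neg[OF subspace_D comm_zl_D[OF assms]]
  by (simp add: fl.br_br[symmetric] fl.br_anti[of zl "fcomm f g"])

text \<open>Jacobi for \<open>p, q, f\<close>: as \<open>[q,f]\<close> and \<open>[f,p]\<close> lie in \<open>R\<close>,
  \<open>[[p,q],f]\<close> lies in \<open>[R,F]\<close>.\<close>
lemma zl_comm_D:
  assumes "p \<in> F" "q \<in> F" "f \<in> F" "g \<in> F"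
    and "b (phi p) (phi q) = z" "b (phi p) (phi f) = 0" "b (phi q) (phi f) = 0"
  shows "fcomm (fcomm zl f) g \<in> D"
proof -
  have r: "fcomm p q - zl \<in> R" using comm_eq_zl[of p q 1] assms by simp
  have qf: "fcomm q f \<in> R" and pf: "fcomm f p \<in> R"
    using assms br_anti[of "phi f" "phi p"] by (simp_all add: pres_R_def phi_comm free_lie.comm)
  have "fcomm (fcomm (fcomm p q) f) g
      + (fcomm (fcomm (fcomm q f) p) g + fcomm (fcomm (fcomm f p) q) g) 
      = fcomm (fcomm (fcomm p q) f + fcomm (fcomm q f) p + fcomm (fcomm f p) q) g"
    by (simp add: fl.br_add_left)
  also have "\<dots> = 0" by (simp only: fl.jacobi' fl.br_zero_left)
  finally have "fcomm (fcomm (fcomm p q) f) g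
      = - (fcomm (fcomm (fcomm q f) p) g + fcomm (fcomm (fcomm f p) q) g)"
    by (simp only: eq_neg_iff_add_eq_0)
  also have "\<dots> \<in> D"
    using qf pf assms by (intro fl.subspace_neg[OF subspace_D] fl.subspace_add[OF subspace_D] D_left)
  finally have "fcomm (fcomm (fcomm p q) f) g \<in> D" .
  \<comment> \<open>\<open>[p,q]\<close> is replaced by \<open>zl\<close>, from which it differs by
    an element of \<open>R\<close>.\<close>
  from fl.subspace_diff[OF subspace_D this D_left[OF r assms(3,4)]]
  show ?thesis by (simp add: fl.br_diff_left)
qed

definition triple :: "nat \<times> nat \<times> nat \<Rightarrow> 'x list \<Rightarrow> 'k" where
  "triple = (\<lambda>(i, j, k). fcomm (fcomm (el i) (el j)) (el k))"

definition ztriple :: "nat \<times> nat \<Rightarrow> 'x list \<Rightarrow> 'k" where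
  "ztriple = (\<lambda>(i, j). fcomm (fcomm zl (el i)) (el j))"

text \<open>Antisymmetry arranges \<open>j < i\<close>; if then \<open>k < j\<close>, Jacobi yields
  two brackets with the least index \<open>k\<close> in second place, both basic.\<close>

lemma triple_in_span:
  assumes S: "fl.subspace S" and T: "triple ` basic_triples d \<subseteq> S"
    and ijk: "i < d" "j < d" "k < d"
  shows "fcomm (fcomm (el i) (el j)) (el k) \<in> S"
proof -
  have base: "fcomm (fcomm (el i) (el j)) (el k) \<in> S" if "j < i" "j \<le> k" "i < d" "k < d" for i j k
  proof -
    have "(i, j, k) \<in> basic_triples d" using that by (simp add: basic_triples_def)
    then show ?thesis using T by (force simp: triple_def)
  qed
  have less: "fcomm (fcomm (el i) (el j)) (el k) \<in> S" if "j < i" "i < d" "k < d" for i j k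
  proof (cases "j \<le> k")
    case False
    have "fcomm (fcomm (el i) (el j)) (el k)
        = fcomm (fcomm (el i) (el k)) (el j) - fcomm (fcomm (el j) (el k)) (el i)"
      using fl.jacobi'[of "el i" "el j" "el k"]
      by (simp add: fl.br_anti[of "el k" "el i"] fl.br_minus_left algebra_simps)
    then show ?thesis using base[of k i j] base[of k j i] False that fl.subspace_diff[OF S] by simp
  qed (use base that in blast)
  consider "j < i" | "i < j" | "i = j" by linarith
  then show ?thesis
  proof cases
    case 2
    then show ?thesis
      using fl.subspace_neg[OF S less[of i j k]] ijk
      by (simp add: fl.br_anti[of "el i" "el j"] fl.br_minus_left)
  qed (use less ijk fl.subspace_0[OF S] in auto)
qed

text \<open>By trilinearity it suffices to bracket the generators of \<open>F\<close> from
  \<open>F_subset_span\<close>. An entry from \<open>R\<close>, or \<open>zl\<close> in last place,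
  gives an element of \<open>D\<close>; the other brackets are triples of the \<open>el i\<close>,
  \<open>ztriple\<close> elements up to sign, or 0.\<close>

lemma mult2_num_subset:
  assumes S: "fl.subspace S" and DS: "D \<subseteq> S" and T: "triple ` basic_triples d \<subseteq> S"
    and Z: "\<And>i k. i < d \<Longrightarrow> k < d \<Longrightarrow> ztriple (i, k) \<in> S"
  shows "mult2_num X phi \<subseteq> S"
  unfolding mult2_num_eq
proof (rule fbrk_fbrk_minimal[OF S])
  fix f g h assume fgh: "f \<in> F" "g \<in> F" "h \<in> F"
  let ?G = "el ` {..<d} \<union> {zl} \<union> R"
  have GF: "?G \<subseteq> F" using lift zl R_subset by auto
  show "fcomm (fcomm f g) h \<in> S"
  proof (rule fl.triple_br_span[OF S])
    fix f g h assume G: "f \<in> ?G" "g \<in> ?G" "h \<in> ?G"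
    then have F: "f \<in> F" "g \<in> F" "h \<in> F" using GF by blast+
    have Z': "fcomm (fcomm zl (el i)) (el k) \<in> S" if "i < d" "k < d" for i k
      using Z[OF that] by (simp add: ztriple_def)
    have Z'': "fcomm (fcomm (el i) zl) (el k) \<in> S" if "i < d" "k < d" for i k
      using fl.subspace_neg[OF S Z'[OF that]] by (simp add: fl.br_anti[of "el i" zl] fl.br_minus_left)
    show "fcomm (fcomm f g) h \<in> S"
    proof (cases "f \<in> R \<or> g \<in> R \<or> h \<in> R \<or> h = zl")
      case True
      then show ?thesis using D_left D_middle D_right' comm_zl_D F DS by blast
    next
      case False
      then have "f = zl \<or> f \<in> el ` {..<d}" "g = zl \<or> g \<in> el ` {..<d}" "h \<in> el ` {..<d}"
        using G by auto
      then show ?thesis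
        using triple_in_span[OF S T] Z' Z'' fl.subspace_0[OF S] by auto
    qed
  qed (use F_subset_span fgh in blast)+
qed

lemma ztriple_D:
  assumes "2 \<le> i" "i < d" "j < d"
  shows "ztriple (i, j) \<in> D"
  unfolding ztriple_def prod.case
  by (rule zl_comm_D[of "el 0" "el 1"]) (use assms br_01 br_0 br_1 in \<open>simp_all add: lift\<close>)

text \<open>For \<open>i < 2\<close> the pair \<open>w\<close>, \<open>w'\<close> takes the part
  that \<open>e 0\<close>, \<open>e 1\<close> have in \<open>ztriple_D\<close>.\<close>

lemma ztriple_D_of_pair:
  assumes "b w w' = z" "b w (e 0) = 0" "b w' (e 0) = 0" "b w (e 1) = 0" "b w' (e 1) = 0"
    and "i < d" "j < d"
  shows "ztriple (i, j) \<in> D"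
proof (cases "2 \<le> i")
  case False
  then have "i = 0 \<or> i = 1" by auto
  then show ?thesis
    unfolding ztriple_def prod.case
    by (intro zl_comm_D[of "lift w" "lift w'"]) (use assms in \<open>auto simp: lift\<close>)
qed (use ztriple_D assms in blast)

text \<open>\<open>zl_sym\<close> swaps the indices modulo \<open>D\<close>, so
  \<open>2 \<le> j\<close> reduces to \<open>2 \<le> i\<close>, and \<open>(1, 0)\<close> to
  \<open>(0, 1)\<close>.\<close>

lemma ztriple_in_span:
  assumes S: "fl.subspace S" and DS: "D \<subseteq> S" and Z: "ztriple ` {(0, 0), (0, 1), (1, 1)} \<subseteq> S"
    and "i < d" "j < d"
  shows "ztriple (i, j) \<in> S"
proof -
  have sym: "ztriple (j, i) \<in> S" if "ztriple (i, j) \<in> S" for i j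
  proof -
    have "ztriple (j, i) - ztriple (i, j) \<in> S"
      using zl_sym[of "el j" "el i"] lift DS by (auto simp: ztriple_def)
    from fl.subspace_add[OF S this that] show ?thesis by simp
  qed
  consider "2 \<le> i" | "2 \<le> j" | "(i = 0 \<or> i = 1) \<and> (j = 0 \<or> j = 1)" by linarith
  then show ?thesis
  proof cases
    case 3
    then show ?thesis using Z sym[of 0 1] by auto
  qed (use ztriple_D sym DS assms in blast)+
qed

end

section \<open>Linear independence\<close>

context heis_presentation
begin

section \<open>The comparison map into words on numbered letters\<close>

definition coord :: "'a \<Rightarrow> nat \<Rightarrow> 'k" where
  "coord x = (SOME a. \<exists>c. x = (\<Sum>i<d. s (a i) (e i)) + s c z)"

definition zcoord :: "'a \<Rightarrow> 'k" where
  "zcoord x = (SOME c. x = (\<Sum>i<d. s (coord x i) (e i)) + s c z)"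

lemma coord: "x = (\<Sum>i<d. s (coord x i) (e i)) + s (zcoord x) z"
proof -
  have "\<exists>c. x = (\<Sum>i<d. s (coord x i) (e i)) + s c z"
    using someI_ex[OF coords[of x]] by (simp only: coord_def)
  then show ?thesis unfolding zcoord_def by (rule someI_ex)
qed

text \<open>Coefficients of the combination of the \<open>t_i\<close> given by \<open>coord\<close>,
  plus \<open>zcoord\<close> times \<open>[t_0, t_1]\<close>. From index \<open>d\<close> on
  \<open>coord\<close> is arbitrary; the argument reads only words in letters below
  \<open>d\<close>.\<close>

definition image_poly :: "'x \<Rightarrow> nat list \<Rightarrow> 'k" where
  "image_poly x w =
     (if length w = 1 then coord (phi (letter x)) (hd w)
      else if w = [0, 1] then zcoord (phi (letter x))
      else if w = [1, 0] then - zcoord (phi (letter x)) else 0)"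

text \<open>A lift of \<open>phi\<close> along the presentation of \<open>L\<close> on free generators \<open>t\<^sub>0, \<dots>, t\<^sub>d\<^sub>-\<^sub>1\<close>
  mapped to \<open>e 0, \<dots>, e (d - 1)\<close>, so that \<open>[t\<^sub>0, t\<^sub>1]\<close> goes to \<open>z\<close>.\<close>
definition psi :: "('x list \<Rightarrow> 'k) \<Rightarrow> nat list \<Rightarrow> 'k" where
  "psi = substitution image_poly"

lemma psi_add: "f \<in> F \<Longrightarrow> g \<in> F \<Longrightarrow> psi (f + g) = psi f + psi g"
  and psi_scale: "psi (fscale c f) = fscale c (psi f)"
  and psi_comm: "f \<in> F \<Longrightarrow> g \<in> F \<Longrightarrow> psi (fcomm f g) = fcomm (psi f) (psi g)"
  and psi_letter: "psi (letter x) = image_poly x"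
  by (simp_all add: psi_def substitution_add substitution_scale substitution_fcomm
      substitution_letter finite_support_free_lie)

lemma psi_0: "psi 0 = 0"
  using psi_scale[of 0 0] by simp

lemma psi_sum: "(\<And>i. i \<in> I \<Longrightarrow> f i \<in> F) \<Longrightarrow> psi (sum f I) = (\<Sum>i\<in>I. psi (f i))"
  by (induction I rule: infinite_finite_induct)
    (simp_all add: psi_0 psi_add fl.subspace_sum[OF subspace_free_lie])

text \<open>The degree 2 part of a Lie element \<open>P\<close> is the sum of
  \<open>P [i, j]\<close> times \<open>[t_i, t_j]\<close> over \<open>i < j\<close>; this is its
  \<open>z\<close>-coordinate once \<open>t_i\<close> is sent to \<open>e i\<close>.\<close>

definition omega_sum :: "(nat list \<Rightarrow> 'k) \<Rightarrow> 'k" where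
  "omega_sum P = (\<Sum>j<d. \<Sum>i<j. \<omega> (e i) (e j) * P [i, j])"

lemma omega_eq_0: "b x y = 0 \<Longrightarrow> \<omega> x y = 0"
  using br_eq[of x y] z_neq_0 by simp

lemma omega_01: "\<omega> (e 0) (e 1) = 1"
  using br_eq[of "e 0" "e 1"] br_01 z_neq_0 scale_right_imp_eq[of z "\<omega> (e 0) (e 1)" 1] by simp

lemma omega_anti: "\<omega> x y = - \<omega> y x"
  using br_anti[of x y] br_eq[of x y] br_eq[of y x] z_neq_0 scale_right_imp_eq[of z "\<omega> x y" "- \<omega> y x"]
  by simp

lemma omega_sum_letters:
  assumes "\<And>i j. 2 \<le> j \<Longrightarrow> i < j \<Longrightarrow> j < d \<Longrightarrow> \<omega> (e i) (e j) * P [i, j] = 0"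
  shows "omega_sum P = P [0, 1]"
proof -
  have "omega_sum P = (\<Sum>j\<in>{1}. \<Sum>i<j. \<omega> (e i) (e j) * P [i, j])"
    unfolding omega_sum_def
  proof (rule sum.mono_neutral_right)
    show "\<forall>j\<in>{..<d} - {1}. (\<Sum>i<j. \<omega> (e i) (e j) * P [i, j]) = 0"
    proof
      fix j assume "j \<in> {..<d} - {1}"
      then have "j = 0 \<or> 2 \<le> j \<and> j < d" by auto
      then show "(\<Sum>i<j. \<omega> (e i) (e j) * P [i, j]) = 0"
        using assms by (auto intro!: sum.neutral)
    qed
  qed (use d2 in auto)
  then show ?thesis using omega_01 by simp
qed

lemma psi_Nil: "f \<in> F \<Longrightarrow> psi f [] = 0"
proof -
  have "F \<subseteq> {f. psi f [] = 0}"
    by (rule free_lie_subset)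
      (simp_all add: psi_letter image_poly_def psi_0 psi_add psi_scale psi_comm,
        simp_all add: fcomm_def fscale_def)
  then show "f \<in> F \<Longrightarrow> psi f [] = 0" by blast
qed

text \<open>In degree 2 a commutator only sees the degree 1 parts, as constant terms vanish;
  generators comply by the opposite values of \<open>image_poly\<close> at \<open>[0, 1]\<close> and
  \<open>[1, 0]\<close>.\<close>

lemma psi_alternating_subset: "F \<subseteq> {f. psi f [i, i] = 0 \<and> psi f [j, i] = - psi f [i, j]}"
proof (rule free_lie_subset, goal_cases gen zero add scale comm)
  case (gen x)
  then show ?case by (auto simp: psi_letter image_poly_def)
next
  case (comm f g)
  then show ?case by (simp add: psi_comm) (simp add: fcomm_def psi_Nil algebra_simps)
next
  case (scale f c)
  then show ?case by (simp add: psi_scale) (simp add: fscale_def)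
qed (simp_all add: psi_0 psi_add)

lemma psi_alternating: "f \<in> F \<Longrightarrow> psi f [i, i] = 0 \<and> psi f [j, i] = - psi f [i, j]"
  using psi_alternating_subset by blast

text \<open>\<open>phi\<close> is \<open>psi\<close> followed by \<open>t_i\<close> going to
  \<open>e i\<close>; degrees above 2 vanish in \<open>L\<close> because \<open>z\<close> is
  central. For a bracket only the degree 1 parts count.\<close>

lemma phi_eq_psi_subset: "F \<subseteq> {f. phi f = (\<Sum>i<d. s (psi f [i]) (e i)) + s (omega_sum (psi f)) z}"
proof (rule free_lie_subset, goal_cases gen zero add scale comm)
  case (gen x)
  have "omega_sum (image_poly x) = image_poly x [0, 1]"
    by (rule omega_sum_letters) (simp add: image_poly_def)
  then show ?case
    using coord[of "phi (letter x)"] by (simp add: psi_letter) (simp add: image_poly_def)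
next
  case zero
  show ?case by (simp add: psi_0 phi_0 omega_sum_def)
next
  case (add f g)
  then show ?case
    by (simp add: psi_add phi_add omega_sum_def scale_left_distrib sum.distrib algebra_simps)
next
  case (scale f c)
  have "omega_sum (fscale c (psi f)) = c * omega_sum (psi f)"
    by (simp add: omega_sum_def fscale_apply sum_distrib_left mult_ac)
  then show ?case
    using scale by (simp add: psi_scale phi_scale fscale_apply scale_right_distrib scale_sum_right)
next
  case (comm f g)
  let ?P = "psi f" and ?Q = "psi g"
  have 0: "?P [] = 0" "?Q [] = 0" using comm psi_Nil by simp_all
  have deg1: "fcomm ?P ?Q [i] = 0" for i by (simp add: fcomm_def 0)
  \<comment> \<open>Antisymmetry of \<open>\<omega>\<close> merges the terms for
    \<open>(i, j)\<close> and \<open>(j, i)\<close> into one commutator coefficient.\<close>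
  have swap: "?P [i] * ?Q [j] * \<omega> (e i) (e j) + ?P [j] * ?Q [i] * \<omega> (e j) (e i)
      = \<omega> (e i) (e j) * fcomm ?P ?Q [i, j]" for i j
    by (subst omega_anti[of "e j" "e i"]) (simp add: fcomm_def 0 algebra_simps)
  have "b (phi f) (phi g) = b (\<Sum>i<d. s (?P [i]) (e i)) (\<Sum>j<d. s (?Q [j]) (e j))"
    using comm by (simp add: br_add_left br_add_right br_scale_left br_scale_right central central')
  also have "\<dots> = (\<Sum>j<d. \<Sum>i<d. s (?P [i] * ?Q [j] * \<omega> (e i) (e j)) z)"
    unfolding br_sum_left br_sum_right br_scale_left br_scale_right br_eq[of "e _" "e _"]
    by (simp add: scale_sum_right mult_ac)
  also have "\<dots> = (\<Sum>i<d. \<Sum>j<d. s (?P [i] * ?Q [j] * \<omega> (e i) (e j)) z)"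
    by (rule sum.swap)
  also have "\<dots> = s (\<Sum>i<d. \<Sum>j<d. ?P [i] * ?Q [j] * \<omega> (e i) (e j)) z"
    by (simp add: scale_sum_left)
  also have "(\<Sum>i<d. \<Sum>j<d. ?P [i] * ?Q [j] * \<omega> (e i) (e j))
      = (\<Sum>j<d. \<Sum>i<j. ?P [i] * ?Q [j] * \<omega> (e i) (e j) + ?P [j] * ?Q [i] * \<omega> (e j) (e i))
        + (\<Sum>i<d. ?P [i] * ?Q [i] * \<omega> (e i) (e i))"
    by (rule sum_square_eq_sum_triangle)
  also have "\<dots> = omega_sum (fcomm ?P ?Q)"
    by (simp only: swap omega_sum_def omega_eq_0[OF br_self]) simp
  finally show ?case
    using comm by (simp add: psi_comm phi_comm deg1)
qed

lemma phi_eq_psi: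
  "f \<in> F \<Longrightarrow> phi f = (\<Sum>i<d. s (psi f [i]) (e i)) + s (omega_sum (psi f)) z"
  using phi_eq_psi_subset by blast

text \<open>Compare coordinates in \<open>phi (el i) = e i\<close>.\<close>

lemma psi_el:
  assumes "i < d" "j < d"
  shows "psi (el i) [j] = (if i = j then 1 else 0)"
proof -
  define a where "a j = psi (el i) [j] - (if i = j then 1 else 0)" for j
  have "e i = (\<Sum>j<d. s (psi (el i) [j]) (e j)) + s (omega_sum (psi (el i))) z"
    using phi_eq_psi[of "el i"] lift(1) by (simp only: lift(2))
  moreover have "(\<Sum>j<d. s (if i = j then 1 else 0) (e j)) = e i"
    using assms by (simp add: if_distrib[of "\<lambda>c. s c _"] sum.delta cong: if_cong)
  ultimately have "(\<Sum>j<d. s (a j) (e j)) + s (omega_sum (psi (el i))) z = 0"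
    unfolding a_def scale_left_diff_distrib sum_subtractf by (simp add: algebra_simps)
  then have "a j = 0" using coords_0 assms by blast
  then show ?thesis by (simp add: a_def)
qed

lemma psi_R: "r \<in> R \<Longrightarrow> i < d \<Longrightarrow> psi r [i] = 0"
  and omega_sum_R: "r \<in> R \<Longrightarrow> omega_sum (psi r) = 0"
  using phi_eq_psi[of r] coords_0[of "\<lambda>i. psi r [i]" "omega_sum (psi r)"]
  by (simp_all add: pres_R_def)

text \<open>On letters below \<open>d\<close>, \<open>psi r\<close> starts in degree 2 and the other
  two factors in degree 1, so the bracket starts in degree 4.\<close>

lemma psi_D_3:
  assumes "f \<in> D" "i < d" "j < d" "k < d"
  shows "psi f [i, j, k] = 0"
proof -
  let ?S = "{f \<in> F. \<forall>i<d. \<forall>j<d. \<forall>k<d. psi f [i, j, k] = 0}"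
  have "D \<subseteq> ?S"
    unfolding mult2_den_def
  proof (rule fbrk_fbrk_minimal)
    show "fl.subspace ?S"
      by (auto simp: fl.subspace_def free_lie.intros psi_0 psi_add psi_scale fscale_apply)
    fix r f g assume rfg: "r \<in> R" "f \<in> F" "g \<in> F"
    then have "r \<in> F" using R_subset by blast
    then show "fcomm (fcomm r f) g \<in> ?S"
      using rfg by (auto simp: free_lie.comm psi_comm) (simp add: fcomm_def psi_Nil psi_R)
  qed
  then show ?thesis using assms by blast
qed

text \<open>In degree 4 only the degree 2 part of \<open>psi r\<close> contributes. Under
  \<open>comm\<close>, \<open>(0, 1)\<close> is the only pair \<open>i < j\<close> with nonzero
  \<open>\<omega>\<close>, so \<open>omega_sum_R\<close> kills the coefficient at
  \<open>[0, 1]\<close>, and alternation the other words in 0 and 1.\<close>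

lemma psi_D_4:
  assumes comm: "\<forall>i j. 2 \<le> i \<longrightarrow> i < d \<longrightarrow> 2 \<le> j \<longrightarrow> j < d \<longrightarrow> b (e i) (e j) = 0"
    and "f \<in> D" "i < 2" "j < 2" "k < 2" "l < 2"
  shows "psi f [i, j, k, l] = 0"
proof -
  let ?S = "{f \<in> F. \<forall>i<2. \<forall>j<2. \<forall>k<2. \<forall>l<2. psi f [i, j, k, l] = 0}"
  have "D \<subseteq> ?S"
    unfolding mult2_den_def
  proof (rule fbrk_fbrk_minimal)
    show "fl.subspace ?S"
      by (auto simp: fl.subspace_def free_lie.intros psi_0 psi_add psi_scale fscale_apply)
    fix r f g assume rfg: "r \<in> R" "f \<in> F" "g \<in> F"
    then have r: "r \<in> F" using R_subset by blast
    have "\<omega> (e i) (e j) = 0" if "2 \<le> j" "i < j" "j < d" for i j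
    proof -
      consider "i = 0" | "i = 1" | "2 \<le> i" by linarith
      then show ?thesis
        using that br_0[of j] br_1[of j] comm by cases (auto intro!: omega_eq_0)
    qed
    then have "omega_sum (psi r) = psi r [0, 1]"
      by (intro omega_sum_letters) simp
    then have "psi r [0, 1] = 0" using omega_sum_R rfg by simp
    moreover have "psi r [1, 0] = - psi r [0, 1]" "psi r [0, 0] = 0" "psi r [1, 1] = 0"
      using psi_alternating[OF r] by blast+
    ultimately have "psi r [i, j] = 0" if "i < 2" "j < 2" for i j
      using that by (auto simp: less_2_cases_iff)
    moreover have "psi r [i] = 0" if "i < 2" for i
      using psi_R[OF rfg(1), of i] d2 that by simp
    ultimately show "fcomm (fcomm r f) g \<in> ?S"
      using rfg r by (auto simp: free_lie.comm psi_comm) (simp add: fcomm_def psi_Nil)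
  qed
  then show ?thesis using assms by blast
qed

section \<open>Coefficients dual to the spanning elements\<close>

lemma triple_F: "triple t \<in> F" and ztriple_F: "ztriple p \<in> F"
  by (simp_all add: triple_def ztriple_def split_beta free_lie.comm lift zl)

lemma psi_el_letter: "i < d \<Longrightarrow> j < d \<Longrightarrow> psi (el i) [j] = letter i [j]"
  by (simp add: psi_el letter_def)

lemma letter_Nil: "letter x [] = 0"
  by (simp add: letter_def)

lemma psi_triple:
  assumes "i < d" "j < d" "k < d" "p < d" "q < d" "r < d"
  shows "psi (triple (i, j, k)) [p, q, r]
    = fcomm (fcomm (letter i) (letter j)) (letter k) [p, q, r]"
  using assms
  by (simp add: triple_def psi_comm free_lie.comm lift)
    (simp add: fcomm_def psi_Nil lift psi_el_letter letter_Nil)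

lemma psi_ztriple_3:
  assumes "i < d" "j < d" "p < d" "q < d" "r < d"
  shows "psi (ztriple (i, j)) [p, q, r] = 0"
  using assms d2
  by (simp add: ztriple_def zl_def psi_comm free_lie.comm lift) (simp add: fcomm_def psi_Nil lift)

lemma psi_ztriple_4:
  assumes "i < d" "j < d" "p < d" "q < d" "r < d" "t < d"
  shows "psi (ztriple (i, j)) [p, q, r, t]
    = fcomm (fcomm (fcomm (letter 0) (letter 1)) (letter i)) (letter j) [p, q, r, t]"
  using assms d2
  by (simp add: ztriple_def zl_def psi_comm free_lie.comm lift)
    (simp add: fcomm_def psi_Nil lift psi_el_letter letter_Nil)

text \<open>The words \<open>jji\<close> and \<open>jik\<close> are chosen so that their coefficients are \<open>\<plusminus>1\<close>, whatever the
  characteristic.\<close>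
definition triple_coeff :: "nat \<times> nat \<times> nat \<Rightarrow> (nat list \<Rightarrow> 'k) \<Rightarrow> 'k" where
  "triple_coeff = (\<lambda>(i, j, k) P. if k = j then P [j, j, i] else - P [j, i, k])"

text \<open>If \<open>j < k\<close>, only the word \<open>jik\<close> of
  \<open>[[t_i, t_j], t_k]\<close> starts with the least letter; if \<open>k = j\<close>, no other
  basic triple has the same letters.\<close>

lemma triple_coeff_triple:
  assumes "t \<in> basic_triples d" "t' \<in> basic_triples d"
  shows "triple_coeff t (psi (triple t')) = (if t' = t then 1 else 0)"
proof -
  obtain i j k i' j' k' where t: "t = (i, j, k)" "t' = (i', j', k')" by (metis prod_cases3)
  then show ?thesis
    using assms by (auto simp: basic_triples_def triple_coeff_def psi_triple fcomm_def letter_def)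
qed

text \<open>The three commutators differ in how often 0 and 1 occur; each is read at a word where
  its coefficient is 1 or -1 in every characteristic.\<close>

definition ztriple_coeff :: "nat \<times> nat \<Rightarrow> (nat list \<Rightarrow> 'k) \<Rightarrow> 'k" where
  "ztriple_coeff p P = (if p = (0, 0) then P [0, 0, 0, 1]
     else if p = (0, 1) then - P [0, 0, 1, 1] else P [0, 1, 1, 1])"

lemma ztriple_coeff_ztriple:
  assumes "p \<in> {(0, 0), (0, 1), (1, 1)}" "q \<in> {(0, 0), (0, 1), (1, 1)}"
  shows "ztriple_coeff p (psi (ztriple q)) = (if q = p then 1 else 0)"
proof -
  have "0 < d" "1 < d" using d2 by simp_all
  then show ?thesis
    using assms by (auto simp: ztriple_coeff_def psi_ztriple_4) (simp_all add: fcomm_def letter_def)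
qed

lemma sum_fun_apply: "(\<Sum>i\<in>I. f i) x = (\<Sum>i\<in>I. f i x)"
  by (induction I rule: infinite_finite_induct) simp_all

text \<open>Degree 3 sees neither \<open>D\<close> nor the \<open>ztriple\<close> elements, so all
  \<open>c t\<close> vanish; then degree 4 on the letters 0 and 1 gives the
  \<open>c' p\<close>.\<close>

lemma independent_mod_D:
  assumes J: "J \<subseteq> {(0, 0), (0, 1), (1, 1)}"
    and comm: "J \<noteq> {} \<longrightarrow> (\<forall>i j. 2 \<le> i \<longrightarrow> i < d \<longrightarrow> 2 \<le> j \<longrightarrow> j < d \<longrightarrow> b (e i) (e j) = 0)"
    and D: "(\<Sum>t\<in>basic_triples d. fscale (c t) (triple t)) + (\<Sum>p\<in>J. fscale (c' p) (ztriple p)) \<in> D"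
  shows "(\<forall>t\<in>basic_triples d. c t = 0) \<and> (\<forall>p\<in>J. c' p = 0)"
proof -
  let ?I = "basic_triples d"
  have finJ: "finite J" using J finite_subset by blast
  have J2: "i < d" "j < d" if "(i, j) \<in> J" for i j using that J d2 by auto
  define u where "u = (\<Sum>t\<in>?I. fscale (c t) (triple t)) + (\<Sum>p\<in>J. fscale (c' p) (ztriple p))"
  have "psi u = (\<Sum>t\<in>?I. fscale (c t) (psi (triple t))) + (\<Sum>p\<in>J. fscale (c' p) (psi (ztriple p)))"
    unfolding u_def
    by (simp add: psi_add psi_sum psi_scale free_lie.scale triple_F ztriple_F
        fl.subspace_sum[OF subspace_free_lie])
  then have u: "psi u w = (\<Sum>t\<in>?I. c t * psi (triple t) w) + (\<Sum>p\<in>J. c' p * psi (ztriple p) w)" for w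
    by (simp add: sum_fun_apply fscale_def)
  have c: "c t = 0" if t: "t \<in> ?I" for t
  proof -
    have z3: "triple_coeff t (psi (ztriple p)) = 0" if "p \<in> J" for p
      using t J2[of "fst p" "snd p"] that psi_ztriple_3[of "fst p" "snd p"]
      by (auto simp: triple_coeff_def basic_triples_def)
    have "triple_coeff t (psi u) = (\<Sum>t'\<in>?I. c t' * triple_coeff t (psi (triple t')))
        + (\<Sum>p\<in>J. c' p * triple_coeff t (psi (ztriple p)))"
      by (simp add: triple_coeff_def u split_beta sum_negf)
    also have "\<dots> = (\<Sum>t'\<in>?I. if t' = t then c t' else 0)"
      using t z3 by (simp add: triple_coeff_triple if_distrib[of "(*) _"] cong: if_cong)
    also have "\<dots> = c t" using t finite_basic_triples by simp
    finally show ?thesis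
      using t D psi_D_3[of u] by (auto simp: triple_coeff_def basic_triples_def u_def split: if_splits)
  qed
  have "c' p = 0" if p: "p \<in> J" for p
  proof -
    have "ztriple_coeff p (psi u) = (\<Sum>q\<in>J. c' q * ztriple_coeff p (psi (ztriple q)))"
      using c by (simp add: ztriple_coeff_def u sum_negf)
    also have "\<dots> = (\<Sum>q\<in>J. if q = p then c' q else 0)"
    proof (rule sum.cong)
      fix q assume "q \<in> J"
      then have "ztriple_coeff p (psi (ztriple q)) = (if q = p then 1 else 0)"
        using p J by (intro ztriple_coeff_ztriple) blast+
      then show "c' q * ztriple_coeff p (psi (ztriple q)) = (if q = p then c' q else 0)" by simp
    qed simp
    also have "\<dots> = c' p" using p finJ by simp
    finally have "c' p = ztriple_coeff p (psi u)" by simp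
    also have "\<dots> = 0"
    proof -
      have "J \<noteq> {}" "u \<in> D" using p D by (auto simp: u_def)
      with comm have "psi u [i, j, k, l] = 0" if "i < 2" "j < 2" "k < 2" "l < 2" for i j k l
        using that by (intro psi_D_4) simp_all
      then show ?thesis by (simp add: ztriple_coeff_def)
    qed
    finally show ?thesis .
  qed
  then show ?thesis using c by blast
qed

text \<open>Common frame of both cases: \<open>J\<close> indexes the \<open>ztriple\<close> elements
  that survive modulo \<open>D\<close>.\<close>

lemma mult2_iso_abelianI:
  assumes J: "J \<subseteq> {(0, 0), (0, 1), (1, 1)}"
    and comm: "J \<noteq> {} \<longrightarrow> (\<forall>i j. 2 \<le> i \<longrightarrow> i < d \<longrightarrow> 2 \<le> j \<longrightarrow> j < d \<longrightarrow> b (e i) (e j) = 0)"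
    and span: "\<And>S i j. fl.subspace S \<Longrightarrow> D \<subseteq> S \<Longrightarrow> ztriple ` J \<subseteq> S \<Longrightarrow> i < d \<Longrightarrow> j < d
      \<Longrightarrow> ztriple (i, j) \<in> S"
  shows "mult2_iso_abelian X phi (Suc d * d * (d - 1) div 3 + card J)"
proof -
  \<comment> \<open>The disjoint sum keeps the two families apart before independence is
    known.\<close>
  let ?I = "basic_triples d <+> J" and ?v = "case_sum triple ztriple"
  have finJ: "finite J" using J finite_subset by blast
  have img: "?v ` ?I = triple ` basic_triples d \<union> ztriple ` J"
    by (simp add: Plus_def image_Un image_image)
  let ?S = "fl.span (?v ` ?I \<union> D)"
  have S: "?v ` ?I \<union> D \<subseteq> ?S" by (rule fl.span_superset)
  have "quot_dim fscale (mult2_num X phi) D (Suc d * d * (d - 1) div 3 + card J)"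
  proof (rule fl.quot_dimI[of ?I _ ?v])
    show "finite ?I" using finJ finite_basic_triples by simp
    show "card ?I = Suc d * d * (d - 1) div 3 + card J"
      using finJ finite_basic_triples by (simp add: card_Plus card_basic_triples)
    show "?v ` ?I \<subseteq> mult2_num X phi"
      unfolding mult2_num_eq img
      by (auto simp: triple_def ztriple_def intro!: fbrk_base lift(1) zl(1))
    show "mult2_num X phi \<subseteq> ?S"
    proof (rule mult2_num_subset)
      show "triple ` basic_triples d \<subseteq> ?S" and DS: "D \<subseteq> ?S"
        using S unfolding img le_sup_iff by simp_all
      have JS: "ztriple ` J \<subseteq> ?S" using S unfolding img le_sup_iff by simp
      show "ztriple (i, k) \<in> ?S" if "i < d" "k < d" for i k
        by (rule span[OF fl.subspace_span DS JS that])
    qed (rule fl.subspace_span)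
    show "\<forall>i\<in>?I. c i = 0" if "(\<Sum>i\<in>?I. fscale (c i) (?v i)) \<in> D" for c
    proof -
      have "(\<Sum>t\<in>basic_triples d. fscale (c (Inl t)) (triple t))
          + (\<Sum>p\<in>J. fscale (c (Inr p)) (ztriple p)) \<in> D"
        using that by (simp add: sum.Plus finJ finite_basic_triples)
      from independent_mod_D[OF J comm this] show ?thesis by (auto simp: Plus_def)
    qed
  qed (rule subspace_D)
  then show ?thesis using mult2_num_comm by (simp add: mult2_iso_abelian_def)
qed

end

theorem theorem2p13:
  fixes s :: "'k::field \<Rightarrow> 'a::ab_group_add \<Rightarrow> 'a"
    and b :: "'a \<Rightarrow> 'a \<Rightarrow> 'a"
    and n m :: nat
    and X :: "'x set"
    and phi :: "('x list \<Rightarrow> 'k) \<Rightarrow> 'a"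
  assumes "lie_algebra s b"
    and "\<exists>B. finite B \<and> module.span s B = UNIV"
    and "vector_space.dim s (UNIV :: 'a set) = n"
    and "nilpotent_lie s b"
    and "vector_space.dim s (lcs s b 1) = 1"
    and "m \<ge> 1"
    and "heis_plus_abelian s b m (n - 2 * m - 1)"
    and "free_presentation s b X phi"
  shows "mult2_iso_abelian X phi
           (if m > 1 then n * (n - 1) * (n - 2) div 3 else n * (n - 1) * (n - 2) div 3 + 3)"
proof -
  obtain B where B: "finite B" "module.span s B = UNIV" using assms(2) by blast
  obtain e z d \<omega> where basis: "heis_basis s b e z d \<omega>" and n: "n = Suc d"
    and m1: "m = 1 \<longrightarrow> (\<forall>i j. 2 \<le> i \<longrightarrow> i < d \<longrightarrow> 2 \<le> j \<longrightarrow> j < d \<longrightarrow> b (e i) (e j) = 0)"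
    and m2: "m > 1 \<longrightarrow> (\<exists>w w'. b w w' = z \<and> b w (e 0) = 0 \<and> b w' (e 0) = 0
      \<and> b w (e 1) = 0 \<and> b w' (e 1) = 0)"
    by (rule heis_plus_abelian_basis[OF assms(1) B assms(3,5,6,7)])
  interpret heis_basis s b e z d \<omega> by (rule basis)
  interpret heis_presentation s b e z d \<omega> X phi by unfold_locales (rule assms(8))
  show ?thesis
  proof (cases "m > 1")
    case True
    then obtain w w' where w: "b w w' = z" "b w (e 0) = 0" "b w' (e 0) = 0" "b w (e 1) = 0" "b w' (e 1) = 0"
      using m2 by blast
    \<comment> \<open>Every \<open>ztriple\<close> lies in \<open>D\<close>, so \<open>J\<close> is
      empty.\<close>
    have "mult2_iso_abelian X phi (Suc d * d * (d - 1) div 3 + card ({} :: (nat \<times> nat) set))"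
    proof (rule mult2_iso_abelianI)
      show "ztriple (i, j) \<in> S" if "D \<subseteq> S" "i < d" "j < d" for S i j
        using ztriple_D_of_pair[OF w that(2,3)] that(1) by blast
    qed simp_all
    then show ?thesis using True n by simp
  next
    case False
    then have "m = 1" using assms(6) by simp
    have "mult2_iso_abelian X phi (Suc d * d * (d - 1) div 3 + card {(0::nat, 0::nat), (0, 1), (1, 1)})"
    proof (rule mult2_iso_abelianI)
      show "ztriple (i, j) \<in> S"
        if "fl.subspace S" "D \<subseteq> S" "ztriple ` {(0, 0), (0, 1), (1, 1)} \<subseteq> S" "i < d" "j < d" for S i j
        using that by (rule ztriple_in_span)
    qed (use m1 \<open>m = 1\<close> in simp_all)
    moreover have "card {(0::nat, 0::nat), (0, 1), (1, 1)} = 3" by simp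
    ultimately show ?thesis using False n by (simp only:) (simp add: numeral_2_eq_2)
  qed
qed

end
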